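(* Let $n\geqslant 2$ and let $D$ be a complex $n\times n$ matrix with $D\notin\langle E^n\rangle$, i.e. $D$ is not proportional to the unit matrix. Let $N=N(D)$ be the number of linearly independent $n\times n$ matrices commuting with $D$. Then the dimension of the maximal Lie invariance algebra $\mathfrak g^D$ of the system $\ddot{\boldsymbol{x}}=D\boldsymbol{x}$, for the unknown vector-function $\boldsymbol{x}(t)=(x^1(t),\dots,x^n(t))^{\rm T}$, is $2n+N+1$ if $D$ is non-nilpotent, and $2n+N+2$ if $D$ is nilpotent.
   Context: The underlying field is $\mathbb C$ and dimensions are over $\mathbb C$. $E^n$ is the $n\times n$ unit matrix and $\langle E^n\rangle$ is its linear span (so it contains the zero matrix). $N(D)$ is the dimension of the space of complex $n\times n$ matrices $H$ with $HD=DH$. Maximal Lie invariance algebra. For a system $\ddot{\boldsymbol{x}}=\boldsymbol{F}(t,\boldsymbol{x},\dot{\boldsymbol{x}})$ of $n$ second-order ordinary differential equations, consider vector fields $Q=\xi(t,\boldsymbol{x})\partial_t+\eta^a(t,\boldsymbol{x})\partial_{x^a}$ (summation over $a=1,\dots,n$) with smooth coefficients (holomorphic in the complex setting). Write $v^a=\dot x^a$, $D_t=\partial_t+v^a\partial_{x^a}+\ddot x^a\partial_{v^a}$, $\eta^b_{(1)}=D_t\eta^b-v^bD_t\xi$, $\eta^b_{(2)}=D_t\eta^b_{(1)}-\ddot x^bD_t\xi$. The field $Q$ is a Lie symmetry vector field of the system if, for $b=1,\dots,n$, after the substitution $\ddot{\boldsymbol{x}}=\boldsymbol{F}$ one has $$\eta^b_{(2)}=\xi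 F^b_t+\eta^aF^b_{x^a}+\eta^a_{(1)}F^b_{v^a}$$ identically in $(t,\boldsymbol{x},\boldsymbol{v})$. The maximal Lie invariance algebra of the system is the Lie algebra of all its Lie symmetry vector fields. For the system $\ddot{\boldsymbol{x}}=D\boldsymbol{x}$ one takes $\boldsymbol{F}=D\boldsymbol{x}$. *)

theory Defs
  imports "HOL-Analysis.Analysis" "HOL-Library.Function_Algebras"
begin

section \<open>Complex matrices as a complex vector space\<close>

definition cmat_scale :: "complex \<Rightarrow> complex^'n^'n \<Rightarrow> complex^'n^'n" where
  "cmat_scale c H = (\<chi> i j. c * H $ i $ j)"

global_interpretation cmat: vector_space "cmat_scale :: complex \<Rightarrow> complex^'n^'n \<Rightarrow> complex^'n^'n"
  by unfold_locales (auto simp: cmat_scale_def vec_eq_iff algebra_simps)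

definition commutant_dim :: "complex^'n^'n \<Rightarrow> nat" where
  "commutant_dim D = cmat.dim {H. H ** D = D ** H}"

definition nilpotent_matrix :: "complex^'n^'n \<Rightarrow> bool" where
  "nilpotent_matrix D \<longleftrightarrow> (\<exists>k. (((**) D) ^^ k) (mat 1) = 0)"


section \<open>Holomorphic vector fields on the space of $(t, x)$\<close>

text \<open>
  A vector field $\xi\,\partial_t + \eta^a\,\partial_{x^a}$ is represented by the map
  that sends $(t, x)$ to the pair of its coefficients $(\xi(t,x), \eta(t,x))$.
\<close>

type_synonym 'n vector_field = "complex \<times> (complex^'n) \<Rightarrow> complex \<times> (complex^'n)"

definition cscale :: "complex \<Rightarrow> complex \<times> (complex^'n) \<Rightarrow> complex \<times> (complex^'n)" where
  "cscale c p = (c * fst p, c *s snd p)"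

definition vf_scale :: "complex \<Rightarrow> 'n::finite vector_field \<Rightarrow> 'n vector_field" where
  "vf_scale c Q = (\<lambda>p. cscale c (Q p))"

global_interpretation vf: vector_space
  "vf_scale :: complex \<Rightarrow> 'n::finite vector_field \<Rightarrow> 'n vector_field"
  by unfold_locales
    (auto simp: vf_scale_def cscale_def fun_eq_iff vec_eq_iff plus_prod_def algebra_simps)

text \<open>
  Holomorphic in several variables: at every point there is a Frechet derivative,
  and it is linear over the complex numbers, not only over the reals.
\<close>

definition holomorphic_field :: "'n::finite vector_field \<Rightarrow> bool" where
  "holomorphic_field Q \<longleftrightarrow>
     (\<forall>p. \<exists>L. (Q has_derivative L) (at p) \<and> (\<forall>c u. L (cscale c u) = cscale c (L u)))"

definition field_xi :: "'n::finite vector_field \<Rightarrow> complex \<Rightarrow> complex^'n \<Rightarrow> complex" where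
  "field_xi Q t x = fst (Q (t, x))"

definition field_eta :: "'n::finite vector_field \<Rightarrow> complex \<Rightarrow> complex^'n \<Rightarrow> complex^'n" where
  "field_eta Q t x = snd (Q (t, x))"


section \<open>Prolongation and Lie symmetries\<close>

text \<open>
  Functions of $(t, x)$ are regarded as functions of $(t, x, v)$ that do not depend on $v$.
\<close>

type_synonym 'n jet_fun = "complex \<Rightarrow> complex^'n \<Rightarrow> complex^'n \<Rightarrow> complex"

definition partial_t :: "'n::finite jet_fun \<Rightarrow> 'n jet_fun" where
  "partial_t f t x v = deriv (\<lambda>s. f s x v) t"

definition partial_x :: "'n::finite \<Rightarrow> 'n jet_fun \<Rightarrow> 'n jet_fun" where
  "partial_x a f t x v = deriv (\<lambda>s. f t (x + axis a s) v) 0"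

definition partial_v :: "'n::finite \<Rightarrow> 'n jet_fun \<Rightarrow> 'n jet_fun" where
  "partial_v a f t x v = deriv (\<lambda>s. f t x (v + axis a s)) 0"

text \<open>
  In the total derivative the second-order jet coordinate $w = \ddot x$ is a parameter,
  independent of $(t, x, v)$.
\<close>

definition total_deriv :: "complex^'n \<Rightarrow> 'n::finite jet_fun \<Rightarrow> 'n jet_fun" where
  "total_deriv w f t x v =
     partial_t f t x v + (\<Sum>a\<in>UNIV. v $ a * partial_x a f t x v)
       + (\<Sum>a\<in>UNIV. w $ a * partial_v a f t x v)"

text \<open>
  \<open>prolong1 Q w b\<close> does not actually depend on \<open>w\<close>, since the coefficients of \<open>Q\<close> do not
  depend on $v$. Hence \<open>total_deriv w\<close>, which has no term for the derivative in $w$, is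
  its full total derivative in \<open>prolong2\<close>.
\<close>

definition prolong1 :: "'n::finite vector_field \<Rightarrow> complex^'n \<Rightarrow> 'n \<Rightarrow> 'n jet_fun" where
  "prolong1 Q w b t x v =
     total_deriv w (\<lambda>t x v. field_eta Q t x $ b) t x v
       - v $ b * total_deriv w (\<lambda>t x v. field_xi Q t x) t x v"

definition prolong2 :: "'n::finite vector_field \<Rightarrow> complex^'n \<Rightarrow> 'n \<Rightarrow> 'n jet_fun" where
  "prolong2 Q w b t x v =
     total_deriv w (prolong1 Q w b) t x v
       - w $ b * total_deriv w (\<lambda>t x v. field_xi Q t x) t x v"

text \<open>\<open>F\<close> is the right-hand side of the system $\ddot x = F(t, x, \dot x)$.\<close>

definition lie_symmetry ::
    "(complex \<Rightarrow> complex^'n \<Rightarrow> complex^'n \<Rightarrow> complex^'n) \<Rightarrow> 'n::finite vector_field \<Rightarrow> bool" where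
  "lie_symmetry F Q \<longleftrightarrow>
     holomorphic_field Q \<and>
     (\<forall>b t x v.
        prolong2 Q (F t x v) b t x v =
          field_xi Q t x * partial_t (\<lambda>t x v. F t x v $ b) t x v
          + (\<Sum>a\<in>UNIV. field_eta Q t x $ a * partial_x a (\<lambda>t x v. F t x v $ b) t x v)
          + (\<Sum>a\<in>UNIV. prolong1 Q (F t x v) a t x v
                          * partial_v a (\<lambda>t x v. F t x v $ b) t x v))"

definition max_lie_algebra ::
    "(complex \<Rightarrow> complex^'n \<Rightarrow> complex^'n \<Rightarrow> complex^'n) \<Rightarrow> 'n::finite vector_field set" where
  "max_lie_algebra F = {Q. lie_symmetry F Q}"

text \<open>
  The dimension \<open>vf.dim\<close> is 0 for a space of infinite dimension. So a positive value of
  \<open>vf.dim\<close> also says that the space has finite dimension.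
\<close>

end

theory Submission
  imports Defs "HOL-Complex_Analysis.Cauchy_Integral_Formula"
begin

text \<open>
  The idea is to solve the determining equations completely and to count the parameters of their
  solution. Write indices for directional derivatives, \<open>t\<close> for the time direction and \<open>v\<close> for
  the direction of a space vector \<open>v\<close>. Then \<open>Q = (\<xi>, \<eta>)\<close> is a symmetry of \<open>x'' = D x\<close> iff for
  all \<open>t\<close>, \<open>x\<close>, \<open>v\<close>, with \<open>V = (1, v)\<close> and \<open>W = (0, D x)\<close>,
  \<open>\<eta>\<^sub>V\<^sub>V + \<eta>\<^sub>W - (\<xi>\<^sub>V\<^sub>V + \<xi>\<^sub>W) v - 2 \<xi>\<^sub>V D x = D \<eta>\<close> (\<open>lie_symmetry_linear_iff\<close>). This is cubic in \<open>v\<close>,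
  so each of its four coefficients vanishes (\<open>lie_symmetry_determining_equations\<close>).

  The coefficients of degree three and two say that all second space derivatives of \<open>\<xi>\<close> vanish
  and that those of \<open>\<eta>\<close> are given by \<open>\<xi>\<close>. Differentiating the coefficient of degree one
  in a further space direction \<open>y\<close> leaves the algebraic relation
  \<open>(\<xi>\<^sub>t\<^sub>t\<^sub>y - \<xi>\<^sub>D\<^sub>y) v + 2 \<xi>\<^sub>t\<^sub>t\<^sub>v y = 2 \<xi>\<^sub>v D y\<close> for all \<open>v\<close> and \<open>y\<close>. If the covector \<open>\<xi>\<^sub>v\<close> were not
  zero, a nonzero vector \<open>v\<close> in its kernel (there is one, as \<open>n \<ge> 2\<close>) would show that
  \<open>\<xi>\<^sub>t\<^sub>t\<^sub>y = \<xi>\<^sub>D\<^sub>y\<close> for all \<open>y\<close>, and then any \<open>v\<close> with \<open>\<xi>\<^sub>v \<noteq> 0\<close> would make \<open>D\<close> a scalar matrix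
  (\<open>not_scalar_annihilating_covector\<close>). So \<open>\<xi>\<close> depends on \<open>t\<close> only, and \<open>\<eta>\<^sub>v = (\<xi>\<^sub>t / 2) v + H v\<close>
  with a constant matrix \<open>H\<close>. The coefficient of degree zero, differentiated in the direction \<open>y\<close>,
  becomes \<open>(\<xi>\<^sub>t\<^sub>t\<^sub>t / 2) y + [H, D] y = 2 \<xi>\<^sub>t D y\<close>; once more since \<open>D\<close> is not scalar, \<open>\<xi>\<^sub>t\<close> is a
  constant \<open>\<beta>\<close>. Therefore the symmetries are exactly the fields
  \<open>\<xi> = \<alpha> + \<beta> t\<close>, \<open>\<eta> = B x + c(t)\<close> with \<open>[B, D] = 2 \<beta> D\<close> and \<open>c'' = D c\<close>
  (\<open>affine_field_symmetry\<close>, \<open>lie_symmetry_imp_affine\<close>).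

  The solutions \<open>c\<close> contribute \<open>2 n\<close> dimensions, \<open>\<alpha>\<close> contributes one, and the matrices \<open>B\<close> with
  \<open>\<beta> = 0\<close> contribute \<open>N\<close>. The value of \<open>\<beta>\<close> contributes one more exactly if \<open>[K, D] = D\<close> has a
  solution \<open>K\<close>, which means that \<open>D\<close> is nilpotent. In one direction, \<open>[K, D\<^sup>k] = k D\<^sup>k\<close>, and the bounded
  operator \<open>[K, _]\<close> has no eigenvalue beyond its norm
  (\<open>commutator_fixpoint_imp_nilpotent\<close>). In the other direction, the range of \<open>[_, D]\<close> is the
  orthogonal complement, in the trace form, of the matrices commuting with \<open>D\<close>, and the product of
  a nilpotent \<open>D\<close> with such a matrix is nilpotent, so it has trace zero
  (\<open>nilpotent_imp_commutator_fixpoint\<close>).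

  All this uses third derivatives of fields that are only assumed to be complex differentiable once.
  Cauchy's integral formula on complex lines provides them (\<open>entire_dderiv\<close>).
\<close>

section \<open>Entire functions of several complex variables\<close>

type_synonym 'n point = "complex \<times> (complex^'n)"

definition entire :: "('n::finite point \<Rightarrow> complex) \<Rightarrow> bool" where
  "entire f \<longleftrightarrow> (\<forall>p. \<exists>L. (f has_derivative L) (at p) \<and> (\<forall>c u. L (cscale c u) = c * L u))"

definition dderiv :: "'n::finite point \<Rightarrow> ('n point \<Rightarrow> complex) \<Rightarrow> 'n point \<Rightarrow> complex" where
  "dderiv u f p = deriv (\<lambda>s. f (p + cscale s u)) 0"

lemma cscale_simps [simp]:
  "cscale 0 u = 0" "cscale 1 u = u" "cscale c 0 = 0" "cscale c (a, x) = (c * a, c *s x)"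
  by (auto simp: cscale_def vec_eq_iff prod_eq_iff)

lemma cscale_add_left: "cscale (a + b) u = cscale a u + cscale b u"
  and cscale_cscale: "cscale a (cscale b u) = cscale (a * b) u"
  by (auto simp: cscale_def vec_eq_iff prod_eq_iff algebra_simps)

lemma scaleR_eq_cscale: "r *\<^sub>R u = cscale (of_real r) u"
  by (auto simp: cscale_def vec_eq_iff prod_eq_iff scaleR_conv_of_real[where 'a=complex])

lemma bounded_linear_cscale_left: "bounded_linear (\<lambda>c. cscale c u)"
proof -
  have "linear (\<lambda>c. cscale c u)"
    by (rule linearI) (auto simp: cscale_add_left scaleR_eq_cscale cscale_cscale scaleR_conv_of_real)
  then show ?thesis by (rule linear_conv_bounded_linear[THEN iffD1])
qed

lemma continuous_on_cscale [continuous_intros]: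
  assumes "continuous_on S f" "continuous_on S g"
  shows "continuous_on S (\<lambda>x. cscale (f x) (g x))"
proof -
  have "(\<lambda>x. cscale (f x) (g x)) = (\<lambda>x. (f x * fst (g x), \<chi> i. f x * (snd (g x) $ i)))"
    by (auto simp: cscale_def fun_eq_iff vec_eq_iff)
  then show ?thesis using assms by (simp only:) (intro continuous_intros)
qed

lemma entire_has_derivative:
  assumes "entire f"
  shows "(f has_derivative (\<lambda>u. dderiv u f p)) (at p)"
    and dderiv_cscale: "dderiv (cscale c u) f p = c * dderiv u f p"
    and dderiv_add_dir: "dderiv (u + v) f p = dderiv u f p + dderiv v f p"
proof -
  obtain L where L: "(f has_derivative L) (at p)" and Lc: "\<And>c u. L (cscale c u) = c * L u"
    using assms unfolding entire_def by metis
  have *: "dderiv u f p = L u" for u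
  proof -
    have "((\<lambda>s. p + cscale s u) has_derivative (\<lambda>s. cscale s u)) (at 0)"
      by (rule has_derivative_eq_rhs, rule has_derivative_add[OF has_derivative_const
            bounded_linear.has_derivative[OF bounded_linear_cscale_left has_derivative_ident]]) simp
    moreover have "(f has_derivative L) (at (p + cscale 0 u))" using L by simp
    ultimately have "((\<lambda>s. f (p + cscale s u)) has_derivative (\<lambda>s. L (cscale s u))) (at 0)"
      by (rule has_derivative_compose)
    then have "((\<lambda>s. f (p + cscale s u)) has_field_derivative L u) (at 0)"
      by (simp add: has_field_derivative_def Lc mult.commute[of _ "L u"])
    then show ?thesis unfolding dderiv_def by (rule DERIV_imp_deriv)
  qed
  show "(f has_derivative (\<lambda>u. dderiv u f p)) (at p)" using L by (simp add: *)
  show "dderiv (cscale c u) f p = c * dderiv u f p" by (simp add: * Lc)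
  show "dderiv (u + v) f p = dderiv u f p + dderiv v f p"
    using has_derivative_linear[OF L] by (simp add: * linear_add)
qed

lemma entireI:
  assumes "\<And>p. (f has_derivative L p) (at p)" "\<And>p c u. L p (cscale c u) = c * L p u"
  shows "entire f" "dderiv u f p = L p u"
proof -
  show e: "entire f" using assms unfolding entire_def by blast
  show "dderiv u f p = L p u"
    using has_derivative_unique[OF entire_has_derivative(1)[OF e, of p] assms(1)[of p]]
        by (rule fun_cong)
qed

lemma DERIV_dderiv:
  assumes "entire f"
  shows "((\<lambda>s. f (p + cscale s u)) has_field_derivative dderiv u f (p + cscale s u)) (at s)"
proof -
  have "((\<lambda>s. p + cscale s u) has_derivative (\<lambda>s. cscale s u)) (at s)"
    by (rule has_derivative_eq_rhs, rule has_derivative_add[OF has_derivative_const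
          bounded_linear.has_derivative[OF bounded_linear_cscale_left has_derivative_ident]]) simp
  from has_derivative_compose[OF this entire_has_derivative(1)[OF assms]]
  show ?thesis
    by (simp add: has_field_derivative_def dderiv_cscale[OF assms] mult.commute[of _ "dderiv u f _"])
qed

lemma entire_continuous: "entire f \<Longrightarrow> continuous_on S f"
  by (meson continuous_at_imp_continuous_on entire_has_derivative(1) has_derivative_continuous)

definition unit_circle :: "real \<Rightarrow> complex" where
  "unit_circle \<theta> = exp (2 * of_real pi * \<i> * of_real \<theta>)"

lemma unit_circle_nonzero [simp]: "unit_circle \<theta> \<noteq> 0"
  by (simp add: unit_circle_def)

lemma continuous_on_unit_circle [continuous_intros]:
  "continuous_on S f \<Longrightarrow> continuous_on S (\<lambda>x. unit_circle (f x))"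
  unfolding unit_circle_def by (intro continuous_intros)

text \<open>
  Cauchy's formula for the first derivative at the centre of the unit circle in the complex line
  through \<open>p\<close> in the direction \<open>u\<close>. It turns a derivative into an integral of \<open>f\<close> itself, which is
  the source of all further regularity.
\<close>

lemma dderiv_eq_integral:
  assumes "entire f"
  shows "dderiv u f p = integral {0..1} (\<lambda>\<theta>. f (p + cscale (unit_circle \<theta>) u) / unit_circle \<theta>)"
proof -
  let ?g = "\<lambda>s. f (p + cscale s u)"
  have hol: "?g holomorphic_on S" for S
    using DERIV_dderiv[OF assms, of p u]
    by (meson DERIV_subset holomorphic_on_def field_differentiable_def subset_UNIV)
  have circ: "circlepath 0 1 \<theta> = unit_circle \<theta>"
      "vector_derivative (circlepath 0 1) (at \<theta>) = 2 * pi * \<i> * unit_circle \<theta>" for \<theta>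
    by (simp_all add: circlepath_def vector_derivative_part_circlepath,
        simp_all add: part_circlepath_def linepath_def unit_circle_def algebra_simps)
  have "(2 * pi * \<i>) * deriv ?g 0 = contour_integral (circlepath 0 1) (\<lambda>z. ?g z / (z - 0)^2)"
    by (rule Cauchy_contour_integral_circlepath_2[symmetric])
       (auto intro: hol holomorphic_on_imp_continuous_on)
  also have "\<dots> = integral {0..1} (\<lambda>\<theta>. (2 * pi * \<i>) *
                      (f (p + cscale (unit_circle \<theta>) u) / unit_circle \<theta>))"
    unfolding contour_integral_integral circ
    by (rule integral_cong) (simp add: power2_eq_square)
  also have "\<dots> = (2 * pi * \<i>) * 
      integral {0..1} (\<lambda>\<theta>. f (p + cscale (unit_circle \<theta>) u) / unit_circle \<theta>)"
    by (rule integral_mult_right)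
  finally show ?thesis by (simp add: dderiv_def)
qed

lemma continuous_on_dderiv:
  assumes "entire f"
  shows "continuous_on S (dderiv u f)"
proof -
  have "continuous_on S (\<lambda>p. integral (cbox 0 1) (\<lambda>\<theta>. f (p + cscale (unit_circle \<theta>) u) / unit_circle \<theta>))"
    by (rule integral_continuous_on_param)
       (auto simp: case_prod_unfold intro!: continuous_intros continuous_on_compose2[OF entire_continuous[OF assms, of UNIV]])
  then show ?thesis
    by (simp add: dderiv_eq_integral[OF assms, abs_def] cong: continuous_on_cong)
qed

text \<open>
  The Cauchy integral may be differentiated under the integral sign, because the derivative of the
  integrand depends continuously on the point. The resulting formula has the integrand of the
  Cauchy integral of \<open>dderiv v f\<close> along \<open>u\<close>, and so it also gives the symmetry of second derivatives.
\<close>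

lemma
  assumes f: "entire f"
  shows entire_dderiv: "entire (dderiv u f)"
    and dderiv_dderiv_eq_integral: "dderiv v (dderiv u f) p =
      integral {0..1} (\<lambda>\<theta>. dderiv v f (p + cscale (unit_circle \<theta>) u) / unit_circle \<theta>)"
proof -
  let ?F = "\<lambda>p \<theta>. f (p + cscale (unit_circle \<theta>) u) / unit_circle \<theta>"
  let ?D = "\<lambda>p \<theta> v. dderiv v f (p + cscale (unit_circle \<theta>) u) / unit_circle \<theta>"
  have D: "((\<lambda>p. ?F p \<theta>) has_derivative ?D p \<theta>) (at p)" for p \<theta>
  proof -
    have "((\<lambda>p. p + cscale (unit_circle \<theta>) u) has_derivative (\<lambda>v. v)) (at p)"
      by (auto intro!: derivative_eq_intros)
    from has_derivative_compose[OF this entire_has_derivative(1)[OF f]]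
    have "((\<lambda>p. f (p + cscale (unit_circle \<theta>) u)) has_derivative
           (\<lambda>v. dderiv v f (p + cscale (unit_circle \<theta>) u))) (at p)" .
    from bounded_linear.has_derivative[OF bounded_linear_mult_left[of "inverse (unit_circle \<theta>)"] this]
    show ?thesis by (simp add: divide_inverse)
  qed
  \<comment> \<open>Differentiation under the integral needs continuity of the derivative in the operator norm;
    in finite dimension it is enough to have it for each direction.\<close>
  define B where "B p \<theta> = Blinfun (?D p \<theta>)" for p \<theta>
  have B: "blinfun_apply (B p \<theta>) = ?D p \<theta>" for p \<theta>
    unfolding B_def by (rule bounded_linear_Blinfun_apply[OF has_derivative_bounded_linear[OF D]])
  have contD: "continuous_on (UNIV \<times> cbox 0 1) (\<lambda>(p, \<theta>). ?D p \<theta> v)" for v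
    unfolding case_prod_unfold
    by (intro continuous_intros continuous_on_compose2[OF continuous_on_dderiv[OF f, of UNIV]]) auto
  have contB: "continuous_on (UNIV \<times> cbox 0 1) (\<lambda>(p, \<theta>). B p \<theta>)"
    using contD by (intro continuous_on_blinfun_componentwise) (simp add: case_prod_unfold B)
  have contF: "continuous_on (cbox 0 1) (?F p)" for p
    by (intro continuous_intros continuous_on_compose2[OF entire_continuous[OF f, of UNIV]]) auto
  have der: "((\<lambda>p. integral (cbox 0 1) (?F p)) has_derivative
             blinfun_apply (integral (cbox 0 1) (B p))) (at p)" for p
    by (rule leibniz_rule[where U=UNIV])
       (use D contB in \<open>simp_all add: B integrable_continuous[OF contF, unfolded cbox_interval] case_prod_unfold\<close>)
  have intB: "B p integrable_on cbox 0 1" for p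
    using continuous_on_compose2[OF contB, of "cbox 0 1" "\<lambda>\<theta>. (p, \<theta>)"]
    by (intro integrable_continuous) (simp add: continuous_on_Pair image_subset_iff)
  have I: "blinfun_apply (integral (cbox 0 1) (B p)) v = integral {0..1} (\<lambda>\<theta>. ?D p \<theta> v)" for p v
    using blinfun_apply_integral[OF intB] by (simp add: B)
  have der': "(dderiv u f has_derivative (\<lambda>v. integral {0..1} (\<lambda>\<theta>. ?D p \<theta> v))) (at p)" for p
  proof -
    have "dderiv u f = (\<lambda>p. integral (cbox 0 1) (?F p))"
      by (simp add: dderiv_eq_integral[OF f, of u] fun_eq_iff)
    with der[of p] show ?thesis by (simp only: I[abs_def])
  qed
  have lin: "integral {0..1} (\<lambda>\<theta>. ?D p \<theta> (cscale c v)) = c * integral {0..1} (\<lambda>\<theta>. ?D p \<theta> v)" for p c v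
    using integral_mult_right[of "{0..1}" c "\<lambda>\<theta>. ?D p \<theta> v"] by (simp add: dderiv_cscale[OF f])
  show "entire (dderiv u f)" by (rule entireI(1)[OF der' lin])
  show "dderiv v (dderiv u f) p = integral {0..1} (\<lambda>\<theta>. ?D p \<theta> v)"
    by (rule entireI(2)[OF der' lin])
qed

lemma dderiv_commute:
  assumes "entire f"
  shows "dderiv v (dderiv u f) p = dderiv u (dderiv v f) p"
  by (rule trans[OF dderiv_dderiv_eq_integral[OF assms]
        dderiv_eq_integral[OF entire_dderiv[OF assms], symmetric]])

lemma entire_const [simp]: "entire (\<lambda>p. c)" and dderiv_const [simp]: "dderiv u (\<lambda>p. c) p = 0"
  by (rule entireI[of _ "\<lambda>p u. 0"]; simp)+

lemma entire_fst [simp]: "entire fst" and dderiv_fst [simp]: "dderiv u fst p = fst u"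
  by (rule entireI[of _ "\<lambda>p u. fst u"]; auto intro!: derivative_eq_intros simp: cscale_def)+

lemma has_derivative_vec_nth: "(f has_derivative f') F \<Longrightarrow> ((\<lambda>x. f x $ i) has_derivative (\<lambda>x. f' x $ i)) F"
  by (rule bounded_linear.has_derivative[OF bounded_linear_vec_nth])

lemma entire_snd_nth [simp]: "entire (\<lambda>p. snd p $ b)"
  and dderiv_snd_nth [simp]: "dderiv u (\<lambda>p. snd p $ b) p = snd u $ b"
  by (rule entireI[of _ "\<lambda>p u. snd u $ b"];
      auto intro!: has_derivative_vec_nth has_derivative_snd has_derivative_ident simp: cscale_def)+

lemma entire_add:
  assumes "entire f" "entire g"
  shows "entire (\<lambda>p. f p + g p)" and "dderiv u (\<lambda>p. f p + g p) p = dderiv u f p + dderiv u g p"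
  by (rule entireI[of _ "\<lambda>p u. dderiv u f p + dderiv u g p"];
      simp add: has_derivative_add entire_has_derivative(1) assms dderiv_cscale algebra_simps)+

lemma entire_diff:
  assumes "entire f" "entire g"
  shows "entire (\<lambda>p. f p - g p)" and "dderiv u (\<lambda>p. f p - g p) p = dderiv u f p - dderiv u g p"
  by (rule entireI[of _ "\<lambda>p u. dderiv u f p - dderiv u g p"];
      simp add: has_derivative_diff entire_has_derivative(1) assms dderiv_cscale algebra_simps)+

lemma entire_mult:
  assumes "entire f" "entire g"
  shows "entire (\<lambda>p. f p * g p)"
    and "dderiv u (\<lambda>p. f p * g p) p = f p * dderiv u g p + dderiv u f p * g p"
proof -
  let ?L = "\<lambda>p u. f p * dderiv u g p + dderiv u f p * g p"
  have L: "((\<lambda>p. f p * g p) has_derivative ?L p) (at p)" for p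
    by (intro has_derivative_mult entire_has_derivative(1) assms)
  have lin: "?L p (cscale c u) = c * ?L p u" for p c u
    by (simp add: assms dderiv_cscale algebra_simps)
  show "entire (\<lambda>p. f p * g p)" by (rule entireI(1)[OF L lin])
  show "dderiv u (\<lambda>p. f p * g p) p = ?L p u" by (rule entireI(2)[OF L lin])
qed

lemma entire_cmult:
  assumes "entire f"
  shows "entire (\<lambda>p. c * f p)" and "dderiv u (\<lambda>p. c * f p) p = c * dderiv u f p"
  using entire_mult[OF entire_const assms] by simp_all

lemma entire_sum:
  assumes "finite I" and "\<And>i. i \<in> I \<Longrightarrow> entire (f i)"
  shows "entire (\<lambda>p. \<Sum>i\<in>I. f i p)" and "dderiv u (\<lambda>p. \<Sum>i\<in>I. f i p) p = (\<Sum>i\<in>I. dderiv u (f i) p)"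
proof -
  have "entire (\<lambda>p. \<Sum>i\<in>I. f i p) \<and> dderiv u (\<lambda>p. \<Sum>i\<in>I. f i p) p = (\<Sum>i\<in>I. dderiv u (f i) p)"
    using assms by (induction I rule: finite_induct) (simp_all add: entire_add)
  then show "entire (\<lambda>p. \<Sum>i\<in>I. f i p)" "dderiv u (\<lambda>p. \<Sum>i\<in>I. f i p) p = (\<Sum>i\<in>I. dderiv u (f i) p)"
    by blast+
qed

lemma entire_matrix_vector:
  shows "entire (\<lambda>p. (D *v snd p) $ b)" and "dderiv u (\<lambda>p. (D *v snd p) $ b) p = (D *v snd u) $ b"
  by (simp_all add: matrix_vector_mult_def entire_sum entire_cmult)

lemma dderiv_0_dir [simp]: "entire f \<Longrightarrow> dderiv 0 f p = 0"
  using dderiv_cscale[of f 0 0 p] by simp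

lemma dderiv_time_space:
  assumes "entire f"
  shows "dderiv (1, v) f p = dderiv (1, 0) f p + dderiv (0, v) f p"
  using dderiv_add_dir[OF assms, of "(1, 0)" "(0, v)"] by simp

lemma dderiv_space_linear:
  assumes "entire f"
  shows "dderiv (0, v + w) f p = dderiv (0, v) f p + dderiv (0, w) f p"
    and "dderiv (0, c *s v) f p = c * dderiv (0, v) f p"
  using dderiv_add_dir[OF assms, of "(0, v)"
      "(0, w)"] dderiv_cscale[OF assms, of c "(0, v)"] by simp_all

lemma dderiv_space_expansion:
  assumes "entire f"
  shows "dderiv (0, v) f p = (\<Sum>a\<in>UNIV. v $ a * dderiv (0, axis a 1) f p)"
proof -
  have "dderiv (0, \<Sum>a\<in>I. v $ a *s axis a 1) f p = (\<Sum>a\<in>I. v $ a * dderiv (0, axis a 1) f p)"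
    if "finite I" for I
    using that by induction (simp_all add: assms dderiv_space_linear zero_prod_def[symmetric])
  from this[of UNIV] show ?thesis by (simp add: basis_expansion)
qed

lemma cubic_polynomial_eq_0:
  fixes a b c d :: complex
  assumes "\<And>s. a + b * s + c * s^2 + d * s^3 = 0"
  shows "a = 0" "b = 0" "c = 0" "d = 0"
proof -
  have *: "a = 0" "a + b + c + d = 0" "a - b + c - d = 0" "a + b * 2 + c * 4 + d * 8 = 0"
    using assms[of 0] assms[of 1] assms[of "-1"] assms[of 2] by simp_all
  show "a = 0" by (rule *)
  have "(a + b + c + d) + (a - b + c - d) = 0" by (simp only: *(2,3) add_0_left)
  then show c: "c = 0" using *(1) by simp
  have bd: "b = - d" using *(1,2) c by (simp add: eq_neg_iff_add_eq_0)
  then have "6 * d = 0" using *(1,4) c by (simp add: algebra_simps)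
  then show "d = 0" by simp
  with bd show "b = 0" by simp
qed

lemma dderiv_add_dir_twice:
  assumes "entire f"
  shows "dderiv (u + v) (dderiv (u + v) f) p =
     dderiv u (dderiv u f) p + 2 * dderiv u (dderiv v f) p + dderiv v (dderiv v f) p"
proof -
  note e = entire_dderiv[OF assms]
  have "dderiv (u + v) f = (\<lambda>p. dderiv u f p + dderiv v f p)"
    by (simp add: fun_eq_iff dderiv_add_dir[OF assms])
  then have "dderiv w (dderiv (u + v) f) p = dderiv w (dderiv u f) p + dderiv w (dderiv v f) p" for w
    by (simp add: entire_add(2)[OF e e])
  then show ?thesis
    by (simp add: dderiv_add_dir[OF e] dderiv_commute[OF assms, of v u])
qed

lemma dderiv_cscale_twice:
  assumes "entire f"
  shows "dderiv (cscale c u) (dderiv (cscale c u) f) p = c^2 * dderiv u (dderiv u f) p"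
proof -
  note e = entire_dderiv[OF assms]
  have "dderiv (cscale c u) f = (\<lambda>p. c * dderiv u f p)"
    by (simp add: fun_eq_iff dderiv_cscale[OF assms])
  then show ?thesis
    by (simp add: entire_cmult(2)[OF e] dderiv_cscale[OF e] power2_eq_square)
qed

text \<open>The scalar \<open>s\<close> makes the dependence on the velocity polynomial in one complex variable.\<close>

lemma dderiv_jet_twice:
  assumes "entire f"
  shows "dderiv (1, s *s v) (dderiv (1, s *s v) f) p = dderiv (1, 0) (dderiv (1, 0) f) p
     + 2 * s * dderiv (1, 0) (dderiv (0, v) f) p + s^2 * dderiv (0, v) (dderiv (0, v) f) p"
proof -
  have eq: "(1, s *s v) = (1, 0) + cscale s (0, v)" by simp
  have "dderiv (cscale s (0, v)) f = (\<lambda>p. s * dderiv (0, v) f p)"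
    by (rule ext) (rule dderiv_cscale[OF assms])
  then have "dderiv (1, 0) (dderiv (cscale s (0, v)) f) p = s * dderiv (1, 0) (dderiv (0, v) f) p"
    by (simp only: entire_cmult(2)[OF entire_dderiv[OF assms]])
  then show ?thesis
    unfolding eq dderiv_add_dir_twice[OF assms] dderiv_cscale_twice[OF assms] by simp
qed

text \<open>
  The direction \<open>D x\<close> of differentiation depends on the point, whence the extra term
  with \<open>D y\<close>.
\<close>

lemma dderiv_along_linear_vector:
  assumes "entire f"
  shows "entire (\<lambda>p. dderiv (0, D *v snd p) f p)"
    and "dderiv (0, y) (\<lambda>p. dderiv (0, D *v snd p) f p) p =
           dderiv (0, D *v y) f p + dderiv (0, D *v snd p) (dderiv (0, y) f) p"
proof -
  note e = entire_dderiv[OF assms]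
  have eq: "(\<lambda>p. dderiv (0, D *v snd p) f p)
      = (\<lambda>p. \<Sum>a\<in>UNIV. (D *v snd p) $ a * dderiv (0, axis a 1) f p)"
    by (rule ext) (rule dderiv_space_expansion[OF assms])
  have m: "entire (\<lambda>p. (D *v snd p) $ a * dderiv (0, axis a 1) f p)" for a
    by (rule entire_mult(1)[OF entire_matrix_vector(1) e])
  show "entire (\<lambda>p. dderiv (0, D *v snd p) f p)"
    unfolding eq by (rule entire_sum(1)) (simp_all only: finite m)
  have "dderiv (0, y) (\<lambda>p. dderiv (0, D *v snd p) f p) p =
     (\<Sum>a\<in>UNIV. dderiv (0, y) (\<lambda>p. (D *v snd p) $ a * dderiv (0, axis a 1) f p) p)"
    unfolding eq by (rule entire_sum(2)) (simp_all only: finite m)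
  also have "\<dots> = (\<Sum>a\<in>UNIV. (D *v snd p) $ a * dderiv (0, axis a 1) (dderiv (0, y) f) p
                               + (D *v y) $ a * dderiv (0, axis a 1) f p)"
    by (simp only: entire_mult(2)[OF entire_matrix_vector(1) e] entire_matrix_vector(2)
        dderiv_commute[OF assms, of "(0, y)"] snd_conv)
  also have "\<dots> = dderiv (0, D *v y) f p + dderiv (0, D *v snd p) (dderiv (0, y) f) p"
    by (simp only: sum.distrib dderiv_space_expansion[OF assms, of "D *v y"]
        dderiv_space_expansion[OF e, of "D *v snd p"] add.commute)
  finally show "dderiv (0, y) (\<lambda>p. dderiv (0, D *v snd p) f p) p =
           dderiv (0, D *v y) f p + dderiv (0, D *v snd p) (dderiv (0, y) f) p" .
qed

lemma entire_space_constant: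
  assumes "entire f" and "\<And>v p. dderiv (0, v) f p = 0"
  shows "f (t, x) = f (t, 0)"
proof -
  have "((\<lambda>s. f ((t, 0) + cscale s (0, x))) has_field_derivative 0) (at s within UNIV)" for s
    using DERIV_dderiv[OF assms(1), of "(t, 0)" "(0, x)" s] by (simp add: assms(2))
  from has_field_derivative_zero_constant[OF convex_UNIV this]
  obtain k where "\<And>s. f ((t, 0) + cscale s (0, x)) = k" by auto
  from this[of 0] this[of 1] show ?thesis by simp
qed

lemma entire_constant:
  assumes "entire f" and "\<And>v p. dderiv (0, v) f p = 0" and "\<And>p. dderiv (1, 0) f p = 0"
  shows "f p = f q"
proof -
  have "dderiv u f p = 0" for u p
  proof -
    have "u = cscale (fst u) (1, 0) + (0, snd u)" by (simp add: prod_eq_iff)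
    then show ?thesis
      using dderiv_add_dir[OF assms(1)] dderiv_cscale[OF assms(1)] assms(2,3)
      by (metis add_0_right mult_zero_right)
  qed
  then have "(f has_derivative (\<lambda>u. 0)) (at p within UNIV)" for p
    using entire_has_derivative(1)[OF assms(1), of p] by simp
  from has_derivative_zero_constant[OF convex_UNIV this] show ?thesis by (metis UNIV_I)
qed

lemma entire_comp_fst:
  assumes "\<And>t. (g has_field_derivative g' t) (at t)"
  shows "entire (\<lambda>p. g (fst p))" and "dderiv u (\<lambda>p. g (fst p)) p = g' (fst p) * fst u"
proof -
  have d: "((\<lambda>p. g (fst p)) has_derivative (\<lambda>u. g' (fst p) * fst u)) (at p)" for p
    by (rule has_derivative_compose[OF has_derivative_fst[OF has_derivative_ident]])
       (rule assms[unfolded has_field_derivative_def])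
  show "entire (\<lambda>p. g (fst p))" "dderiv u (\<lambda>p. g (fst p)) p = g' (fst p) * fst u"
    by (rule entireI[OF d]; simp add: cscale_def)+
qed

section \<open>Commutators of complex matrices\<close>

lemma matrix_mul_diff_distrib:
  fixes A B C :: "complex^'n^'n"
  shows "A ** (B - C) = A ** B - A ** C" "(B - C) ** A = B ** A - C ** A"
  by (simp_all add: matrix_matrix_mult_def vec_eq_iff right_diff_distrib left_diff_distrib sum_subtractf)

lemma matrix_mul_scaleR:
  fixes A B :: "complex^'n^'n"
  shows "A ** (r *\<^sub>R B) = r *\<^sub>R (A ** B)" "(r *\<^sub>R A) ** B = r *\<^sub>R (A ** B)"
  by (simp_all add: matrix_matrix_mult_def vec_eq_iff scaleR_sum_right)

lemma matrix_mul_add_rdistrib: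
  fixes A B C :: "complex^'n^'n"
  shows "(B + C) ** A = B ** A + C ** A"
  by (simp add: matrix_matrix_mult_def vec_eq_iff distrib_right sum.distrib)

lemma matrix_mul_zero:
  fixes A :: "complex^'n^'n"
  shows "0 ** A = 0" "A ** 0 = 0"
  by (simp_all add: matrix_matrix_mult_def vec_eq_iff)

abbreviation mpow :: "complex^'n^'n \<Rightarrow> nat \<Rightarrow> complex^'n^'n" where
  "mpow A k \<equiv> (((**) A) ^^ k) (mat 1)"

lemma mpow_commute:
  assumes "A ** B = B ** A"
  shows "mpow A k ** B = B ** mpow A k"
  by (induction k) (simp_all add: assms matrix_mul_assoc, metis assms matrix_mul_assoc)

lemma mpow_mult:
  assumes "A ** B = B ** A"
  shows "mpow (A ** B) k = mpow A k ** mpow B k"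
proof (induction k)
  case (Suc k)
  have "(A ** B) ** (mpow A k ** mpow B k) = A ** (B ** mpow A k) ** mpow B k"
    by (simp add: matrix_mul_assoc)
  also have "\<dots> = (A ** mpow A k) ** (B ** mpow B k)"
    by (simp add: mpow_commute[OF assms, symmetric] matrix_mul_assoc)
  finally show ?case using Suc by simp
qed simp

lemma commutator_mpow:
  assumes "K ** D - D ** K = D"
  shows "K ** mpow D k - mpow D k ** K = real k *\<^sub>R mpow D k"
proof (induction k)
  case (Suc k)
  have "K ** (D ** mpow D k) - (D ** mpow D k) ** K
      = (K ** D - D ** K) ** mpow D k + D ** (K ** mpow D k - mpow D k ** K)"
    by (simp add: matrix_mul_diff_distrib matrix_mul_assoc)
  also have "\<dots> = D ** mpow D k + D ** (real k *\<^sub>R mpow D k)"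
    by (simp only: assms Suc)
  finally show ?case by (simp add: matrix_mul_scaleR algebra_simps)
qed simp

text \<open>
  Every nonzero power \<open>D\<^sup>k\<close> would be an eigenvector of the bounded operator \<open>[K, _]\<close> for the
  eigenvalue \<open>k\<close>, which is impossible once \<open>k\<close> exceeds its norm.
\<close>

lemma commutator_fixpoint_imp_nilpotent:
  assumes "K ** D - D ** K = D"
  shows "nilpotent_matrix D"
proof -
  have "linear (\<lambda>X. K ** X - X ** K)"
    by (rule linearI) (simp_all add: matrix_add_ldistrib matrix_mul_add_rdistrib matrix_mul_scaleR algebra_simps)
  then obtain c where c: "\<And>X. norm (K ** X - X ** K) \<le> c * norm X"
    using linear_bounded by blast
  obtain k :: nat where k: "c < real k" using reals_Archimedean2 by blast
  have "real k * norm (mpow D k) \<le> c * norm (mpow D k)"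
    using c[of "mpow D k"] by (simp add: commutator_mpow[OF assms])
  then have "norm (mpow D k) \<le> 0" using k
    by (smt (verit) mult_less_cancel_right)
  then show ?thesis unfolding nilpotent_matrix_def by auto
qed

lemma generalized_inverse_exists:
  fixes M :: "complex^'n^'n"
  shows "\<exists>X. M ** X ** M = M"
proof -
  obtain g where g: "Vector_Spaces.linear (*s) (*s) g" "\<And>v. v \<in> range ((*v) M) \<Longrightarrow> M *v g v = v"
    using vec.linear_exists_right_inverse_on[OF matrix_vector_mul_linear_gen[of M] vec.subspace_UNIV] by auto
  have "(M ** matrix g ** M) *v x = M *v x" for x
    using g(2)[of "M *v x"] by (simp add: matrix_vector_mul_assoc[symmetric] matrix_works[OF g(1)])
  then show ?thesis by (auto simp: matrix_eq)
qed

text \<open>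
  For a generalized inverse \<open>X\<close> of \<open>M\<close>, the product \<open>M X\<close> is a projection onto the range of \<open>M\<close>.
  Hence \<open>M (M X)\<close> has the trace of \<open>(M X) M = M\<close>, but it is nilpotent of a smaller order, because
  its power of order \<open>k\<close> is \<open>M\<^sup>k (M X)\<close>.
\<close>

lemma trace_nilpotent_eq_0:
  assumes "mpow M k = 0"
  shows "trace M = 0"
proof -
  \<comment> \<open>Order one, where \<open>M = 0\<close>, is the start of the induction; order zero occurs in no dimension.\<close>
  have "mpow M (Suc k) = 0" using assms by (simp add: matrix_mul_zero)
  then show ?thesis
  proof (induction k arbitrary: M)
    case 0
    then show ?case by (simp add: trace_def)
  next
    case (Suc k)
    obtain X where X: "M ** X ** M = M" using generalized_inverse_exists by blast
    let ?N = "M ** (M ** X)"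
    have comm: "mpow M j ** M = M ** mpow M j" for j by (rule mpow_commute) simp
    have pow: "mpow ?N (Suc j) = mpow M (Suc (Suc j)) ** X" for j
    proof (induction j)
      case (Suc j)
      have "mpow ?N (Suc (Suc j)) = ?N ** (M ** (M ** mpow M j) ** X)" using Suc by simp
      also have "\<dots> = M ** (M ** X ** M) ** (M ** mpow M j) ** X"
        by (simp only: matrix_mul_assoc)
      finally show ?case by (simp only: X) (simp add: matrix_mul_assoc)
    qed (simp add: matrix_mul_assoc)
    have "mpow ?N (Suc k) = 0"
      unfolding pow using Suc.prems by (simp add: matrix_mul_zero)
    then have "trace ?N = 0" by (rule Suc.IH)
    also have "trace ?N = trace (M ** X ** M)" by (rule trace_mul_sym)
    finally show ?case by (simp add: X)
  qed
qed

lemma inner_eq_Re_trace: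
  fixes X Z :: "complex^'n^'n"
  shows "Z \<bullet> X = Re (trace (X ** (\<chi> i j. cnj (Z $ j $ i))))"
  by (simp add: trace_def matrix_matrix_mult_def inner_vec_def inner_complex_def algebra_simps)

text \<open>
  Fredholm alternative: let \<open>Z\<close> be the component of \<open>D\<close> orthogonal to the range of \<open>[_, D]\<close>.
  Its adjoint \<open>Z'\<close> satisfies \<open>trace ([K, D] Z') = trace (K [D, Z'])\<close> for all \<open>K\<close>, and therefore commutes
  with \<open>D\<close>. Then \<open>D Z'\<close> is nilpotent, so \<open>D\<close> is orthogonal to \<open>Z\<close>, and \<open>Z = 0\<close>.
\<close>

lemma nilpotent_imp_commutator_fixpoint:
  assumes "nilpotent_matrix D"
  shows "\<exists>K. K ** D - D ** K = D"
proof -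
  let ?ad = "\<lambda>K. K ** D - D ** K"
  have "linear ?ad"
    by (rule linearI) (simp_all add: matrix_add_ldistrib matrix_mul_add_rdistrib matrix_mul_scaleR algebra_simps)
  then have sub: "subspace (range ?ad)" by (rule linear_subspace_image) simp
  obtain Y Z where Y: "Y \<in> range ?ad" and Z: "\<And>W. W \<in> range ?ad \<Longrightarrow> Z \<bullet> W = 0" and D: "D = Y + Z"
    using orthogonal_subspace_decomp_exists[of "range ?ad" D]
    unfolding orthogonal_def span_eq_iff[THEN iffD2, OF sub] by blast
  define Z' where "Z' = (\<chi> i j. cnj (Z $ j $ i))"
  define C where "C = D ** Z' - Z' ** D"
  define C' where "C' = (\<chi> i j. cnj (C $ j $ i))"
  \<comment> \<open>The real inner product sees only the real part of the trace; testing with the adjoint of the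
    commutator makes that part a squared norm.\<close>
  have "0 = Z \<bullet> ?ad C'" using Z by auto
  also have "\<dots> = Re (trace (C' ** D ** Z') - trace (D ** (C' ** Z')))"
    by (simp add: inner_eq_Re_trace Z'_def matrix_mul_diff_distrib trace_sub matrix_mul_assoc)
  also have "trace (D ** (C' ** Z')) = trace (C' ** Z' ** D)" by (rule trace_mul_sym)
  also have "trace (C' ** D ** Z') - trace (C' ** Z' ** D) = trace (C' ** C)"
    by (simp add: C_def matrix_mul_diff_distrib trace_sub matrix_mul_assoc)
  also have "\<dots> = trace (C ** C')" by (rule trace_mul_sym)
  also have "Re \<dots> = C \<bullet> C" by (simp add: inner_eq_Re_trace C'_def)
  finally have comm: "D ** Z' = Z' ** D" by (simp add: C_def)
  obtain k where "mpow D k = 0" using assms unfolding nilpotent_matrix_def by blast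
  then have "mpow (D ** Z') k = 0" by (simp add: mpow_mult[OF comm] matrix_mul_zero)
  then have "Z \<bullet> D = 0" by (simp add: inner_eq_Re_trace trace_nilpotent_eq_0 Z'_def)
  then have "Z = 0" using Z[OF Y] D by (simp add: inner_add_right)
  with D Y have "D \<in> range ?ad" by simp
  then show ?thesis by (auto simp: image_iff intro: sym)
qed

lemma not_scalar_combination_eq_0:
  fixes D :: "complex^'n^'n"
  assumes "D \<notin> cmat.span {mat 1}" and "\<And>y. a *s y = b *s (D *v y)"
  shows "b = 0"
proof (rule ccontr)
  assume b: "b \<noteq> 0"
  have "D *v y = cmat_scale (a / b) (mat 1) *v y" for y
  proof -
    have "cmat_scale (a / b) (mat 1) *v y = (1 / b) *s (a *s (mat 1 *v y))"
      by (simp add: cmat_scale_def vec_eq_iff matrix_vector_mult_def sum_distrib_left mult.assoc)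
    also have "\<dots> = D *v y" using b by (simp add: assms(2) vec_eq_iff)
    finally show ?thesis by simp
  qed
  then have "D = cmat_scale (a / b) (mat 1)" by (simp add: matrix_eq)
  then show False using assms(1) by (metis cmat.span_base cmat.span_scale insertI1)
qed

text \<open>
  A nonzero \<open>u\<close> with \<open>lam u = 0\<close> turns the hypothesis into \<open>\<rho> y u + 2 mu u y = 0\<close>. Choosing \<open>y\<close>
  independent of \<open>u\<close> gives \<open>mu u = 0\<close>, hence \<open>\<rho> = 0\<close>, and what is left of the hypothesis says that
  \<open>D\<close> is scalar wherever \<open>lam\<close> does not vanish.
\<close>

lemma not_scalar_annihilating_covector:
  fixes D :: "complex^'n^'n" and lam mu \<rho> :: "complex^'n \<Rightarrow> complex"
  assumes "CARD('n) \<ge> 2" "D \<notin> cmat.span {mat 1}"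
    and add: "\<And>u v. lam (u + v) = lam u + lam v" and scale: "\<And>c v. lam (c *s v) = c * lam v"
    and eq: "\<And>v y. \<rho> y *s v + (2 * mu v) *s y = (2 * lam v) *s (D *v y)"
  shows "lam v = 0"
proof (rule ccontr)
  assume v: "lam v \<noteq> 0"
  obtain i j :: 'n where ij: "i \<noteq> j"
    using assms(1) card_le_Suc0_iff_eq[of "UNIV :: 'n set"] by auto
  have "\<exists>u. u \<noteq> 0 \<and> lam u = 0"
  proof (cases "lam (axis i 1) = 0")
    case True
    then show ?thesis by (intro exI[of _ "axis i 1"]) simp
  next
    case False
    let ?u = "(- lam (axis i 1)) *s axis j 1 + lam (axis j 1) *s axis i 1 :: complex^'n"
    have "?u $ j \<noteq> (0 :: complex^'n) $ j" using False ij by (simp add: axis_def)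
    then have "?u \<noteq> 0" by (rule contrapos_nn) (simp only:)
    moreover have "lam ?u = 0" by (simp only: add scale) simp
    ultimately show ?thesis by blast
  qed
  then obtain u where u: "u \<noteq> 0" "lam u = 0" by blast
  from u(1) obtain k where k: "u $ k \<noteq> 0" by (auto simp: vec_eq_iff)
  have **: "\<rho> y * u $ l + 2 * mu u * y $ l = 0" for y l
    using arg_cong[OF eq[of y u], of "\<lambda>x. x $ l"] u(2) by simp
  obtain l where l: "l \<noteq> k" using ij that[of i] that[of j] by (cases "i = k") simp_all
  have "\<rho> (axis l 1) = 0" using **[of "axis l 1" k] l k by (simp add: axis_def)
  then have "mu u = 0" using **[of "axis l 1" l] by simp
  then have "\<rho> y = 0" for y using **[of y k] k by simp
  then have "(2 * mu v) *s y = (2 * lam v) *s (D *v y)" for y using eq[of y v] by simp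
  from not_scalar_combination_eq_0[OF assms(2) this] v show False by simp
qed

lemma commutator_cmat_scale:
  "cmat_scale r B ** D - D ** cmat_scale r B = cmat_scale r (B ** D - D ** B)"
  by (simp add: cmat_scale_def matrix_matrix_mult_def vec_eq_iff sum_distrib_left algebra_simps)

lemma commutator_vector:
  fixes B D :: "complex^'n^'n"
  shows "B ** D - D ** B = cmat_scale k D \<longleftrightarrow> (\<forall>y. B *v (D *v y) - D *v (B *v y) = k *s (D *v y))"
proof -
  have "cmat_scale k D *v y = k *s (D *v y)" for y
    by (simp add: cmat_scale_def vec_eq_iff matrix_vector_mult_def sum_distrib_left mult.assoc)
  then show ?thesis
    by (simp add: matrix_eq matrix_vector_mult_diff_rdistrib matrix_vector_mul_assoc)
qed

lemma matrix_vector_axis_nth: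
  fixes B :: "complex^'n^'n"
  shows "(B *v axis j 1) $ i = B $ i $ j"
  by (simp add: matrix_vector_mult_def axis_def if_distrib[of "\<lambda>z. _ * z"] cong: if_cong)

section \<open>Solutions of the linear system\<close>

text \<open>A solution of \<open>c'' = D c\<close> as the first-order system for \<open>c\<close> and its derivative \<open>c'\<close>.\<close>

definition solution_pair :: "complex^'n^'n \<Rightarrow> (complex \<Rightarrow> complex^'n) \<Rightarrow> (complex \<Rightarrow> complex^'n) \<Rightarrow> bool" where
  "solution_pair D c c' \<longleftrightarrow> (\<forall>t b. ((\<lambda>s. c s $ b) has_field_derivative c' t $ b) (at t) \<and>
                         ((\<lambda>s. c' s $ b) has_field_derivative (D *v c t) $ b) (at t))"

text \<open>The derivatives at \<open>0\<close> of the solution with initial value \<open>a\<close> and initial velocity \<open>a'\<close>.\<close>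

primrec solution_deriv :: "complex^'n^'n \<Rightarrow> complex^'n \<Rightarrow> complex^'n \<Rightarrow> nat \<Rightarrow> (complex^'n)" where
  "solution_deriv D a a' 0 = a"
| "solution_deriv D a a' (Suc k) = solution_deriv D a' (D *v a) k"

lemma solution_deriv_Suc_Suc: "solution_deriv D a a' (Suc (Suc k)) = D *v solution_deriv D a a' k"
  by (induction k arbitrary: a a') simp_all

lemma solution_deriv_bound:
  fixes D :: "complex^'n^'n"
  obtains M C where "\<And>k. norm (solution_deriv D a a' k) \<le> M * C ^ k"
proof -
  obtain B where B: "\<And>x. norm (D *v x) \<le> B * norm x"
    using linear_bounded[OF matrix_vector_mul_linear[of D]] by blast
  define C where "C = max 1 B"
  define M where "M = max (norm a) (norm a')"
  have C: "1 \<le> C" "B \<le> C" and M: "norm a \<le> M" "norm a' \<le> M" "0 \<le> M"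
    by (simp_all add: C_def M_def le_max_iff_disj)
  have "norm (solution_deriv D a a' k) \<le> M * C ^ k
      \<and> norm (solution_deriv D a a' (Suc k)) \<le> M * C ^ Suc k" for k
  proof (induction k)
    case 0
    have "norm a' * 1 \<le> M * C" by (rule mult_mono) (use C M in simp_all)
    then show ?case using M by simp
  next
    case (Suc k)
    have "norm (solution_deriv D a a' (Suc (Suc k))) \<le> B * norm (solution_deriv D a a' k)"
      by (simp only: solution_deriv_Suc_Suc B)
    also have "\<dots> \<le> (C * C) * (M * C ^ k)"
    proof (rule mult_mono)
      have "B * 1 \<le> C * C" by (rule mult_mono) (use C in simp_all)
      then show "B \<le> C * C" by simp
      show "0 \<le> C * C" by simp
    qed (use Suc in simp_all)
    finally have "norm (solution_deriv D a a' (Suc (Suc k))) \<le> M * C ^ Suc (Suc k)"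
      by (simp add: mult.assoc mult.left_commute)
    then show ?case using Suc by (simp only:)
  qed
  then show ?thesis using that by blast
qed

lemma solution_pair_exists:
  fixes D :: "complex^'n^'n"
  shows "\<exists>c c'. solution_pair D c c' \<and> c 0 = a \<and> c' 0 = a'"
proof -
  define f where "f j t = (\<chi> b. \<Sum>k. (solution_deriv D a a' (k + j) $ b / fact k) * t ^ k)" for j t
  obtain M C where MC: "\<And>k. norm (solution_deriv D a a' k) \<le> M * C ^ k"
    using solution_deriv_bound by blast
  have summ: "summable (\<lambda>k. (solution_deriv D a a' (k + j) $ b / fact k) * t ^ k)" for j b t
  proof (rule summable_comparison_test'[where N=0])
    show "summable (\<lambda>k. (M * C ^ j) * (inverse (fact k) * (C * norm t) ^ k))"
      by (intro summable_mult summable_exp)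
    show "norm ((solution_deriv D a a' (k + j) $ b / fact k) * t ^ k)
            \<le> (M * C ^ j) * (inverse (fact k) * (C * norm t) ^ k)" for k
    proof -
      have "norm (solution_deriv D a a' (k + j) $ b) \<le> M * C ^ (k + j)"
        by (rule order_trans[OF Finite_Cartesian_Product.norm_nth_le MC])
      then have "norm (solution_deriv D a a' (k + j) $ b) * (norm t ^ k / fact k)
              \<le> (M * C ^ (k + j)) * (norm t ^ k / fact k)"
        by (rule mult_right_mono) simp
      also have "\<dots> = (M * C ^ j) * (inverse (fact k) * (C * norm t) ^ k)"
        by (simp add: power_add power_mult_distrib divide_inverse mult_ac)
      finally show ?thesis
        by (simp add: norm_mult norm_divide norm_power)
    qed
  qed
  have diffs: "diffs (\<lambda>k. solution_deriv D a a' (k + j) $ b / fact k)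
             = (\<lambda>k. solution_deriv D a a' (k + Suc j) $ b / fact k)" for j b
    by (rule ext) (simp add: diffs_def del: solution_deriv.simps of_nat_Suc)
  have der: "((\<lambda>s. f j s $ b) has_field_derivative f (Suc j) t $ b) (at t)" for j b t
    using termdiffs_strong_converges_everywhere[OF summ[of j b]]
    by (simp add: f_def diffs)
  have f2: "f (Suc (Suc 0)) t = D *v f 0 t" for t
    unfolding vec_eq_iff
  proof
    fix b
    have s0: "summable (\<lambda>k. (solution_deriv D a a' k $ i / fact k) * t ^ k)" for i
      using summ[of 0 i t] by (simp only: add_0_right)
    have "(D *v f 0 t) $ b = (\<Sum>i\<in>UNIV. \<Sum>k. D $ b $ i * ((solution_deriv D a a' k $ i / fact k) * t ^ k))"
      by (simp only: matrix_vector_mult_def f_def vec_lambda_beta add_0_right suminf_mult[OF s0])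
    also have "\<dots> = (\<Sum>k. \<Sum>i\<in>UNIV. D $ b $ i * ((solution_deriv D a a' k $ i / fact k) * t ^ k))"
      by (intro suminf_sum[symmetric] summable_mult s0)
    also have "\<dots> = (\<Sum>k. ((D *v solution_deriv D a a' k) $ b / fact k) * t ^ k)"
      by (simp only: matrix_vector_mult_def vec_lambda_beta sum_divide_distrib sum_distrib_right
          times_divide_eq_left times_divide_eq_right mult.assoc)
    also have "\<dots> = f (Suc (Suc 0)) t $ b"
      by (simp only: f_def vec_lambda_beta add_Suc_right add_0_right solution_deriv_Suc_Suc)
    finally show "f (Suc (Suc 0)) t $ b = (D *v f 0 t) $ b" by (rule sym)
  qed
  have f0: "f j 0 = solution_deriv D a a' j" for j
    by (simp only: vec_eq_iff f_def vec_lambda_beta powser_zero) simp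
  have "solution_pair D (f 0) (f (Suc 0))"
    unfolding solution_pair_def f2[symmetric] using der by blast
  moreover have "f 0 0 = a" "f (Suc 0) 0 = a'"
    using f0[of 0] f0[of "Suc 0"] by simp_all
  ultimately show ?thesis by blast
qed

lemma solution_pair_lincomb:
  assumes "solution_pair D c c'" "solution_pair D e e'"
  shows "solution_pair D (\<lambda>t. r *s c t + e t) (\<lambda>t. r *s c' t + e' t)"
  using assms unfolding solution_pair_def
  by (auto intro!: derivative_eq_intros simp: matrix_vector_right_distrib vector_scalar_commute)

text \<open>
  All derivatives at \<open>0\<close> vanish, because each of them is a linear combination of the entries of
  \<open>c 0\<close> and \<open>c' 0\<close>; then the entire function \<open>c\<close> is zero. The induction runs over all linear
  functionals \<open>r\<close> at once, since two derivatives replace \<open>r\<close> by \<open>r D\<close>.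
\<close>

lemma solution_pair_eq_0:
  fixes D :: "complex^'n^'n"
  assumes fp: "solution_pair D c c'" and "c 0 = 0" "c' 0 = 0"
  shows "c t = 0"
proof -
  have d: "((\<lambda>s. \<Sum>b\<in>UNIV. r b * c s $ b) has_field_derivative (\<Sum>b\<in>UNIV. r b * c' t $ b)) (at t)" for r t
    using fp unfolding solution_pair_def by (auto intro!: derivative_eq_intros simp: mult.commute)
  have d': "((\<lambda>s. \<Sum>b\<in>UNIV. r b * c' s $ b) has_field_derivative
             (\<Sum>b\<in>UNIV. (\<Sum>a\<in>UNIV. r a * D $ a $ b) * c t $ b)) (at t)" for r t
  proof -
    have "((\<lambda>s. \<Sum>b\<in>UNIV. r b * c' s $ b) has_field_derivative (\<Sum>a\<in>UNIV. r a * (D *v c t) $ a)) (at t)"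
      using fp unfolding solution_pair_def by (auto intro!: derivative_eq_intros simp: mult.commute)
    also have "(\<Sum>a\<in>UNIV. r a * (D *v c t) $ a) = (\<Sum>a\<in>UNIV. \<Sum>b\<in>UNIV. r a * D $ a $ b * c t $ b)"
      by (simp add: matrix_vector_mult_def sum_distrib_left mult.assoc)
    also have "\<dots> = (\<Sum>b\<in>UNIV. (\<Sum>a\<in>UNIV. r a * D $ a $ b) * c t $ b)"
      by (subst sum.swap) (simp add: sum_distrib_right)
    finally show ?thesis .
  qed
  have "(deriv ^^ k) (\<lambda>s. \<Sum>b\<in>UNIV. r b * c s $ b) 0 = 0 \<and> (deriv ^^ k) (\<lambda>s. \<Sum>b\<in>UNIV. r b * c' s $ b) 0 = 0" for k r
  proof (induction k arbitrary: r)
    case 0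
    then show ?case using assms by simp
  next
    case (Suc k)
    have "deriv (\<lambda>s. \<Sum>b\<in>UNIV. r b * c s $ b) = (\<lambda>s. \<Sum>b\<in>UNIV. r b * c' s $ b)"
      using d by (auto intro!: DERIV_imp_deriv)
    moreover have "deriv (\<lambda>s. \<Sum>b\<in>UNIV. r b * c' s $ b)
        = (\<lambda>s. \<Sum>b\<in>UNIV. (\<Sum>a\<in>UNIV. r a * D $ a $ b) * c s $ b)"
      using d' by (auto intro!: DERIV_imp_deriv)
    ultimately show ?case using Suc by (simp add: funpow_Suc_right del: funpow.simps)
  qed
  moreover have "(\<lambda>s. \<Sum>b\<in>UNIV. r b * c s $ b) holomorphic_on UNIV" for r
    using d by (auto simp: holomorphic_on_def field_differentiable_def)
  ultimately have z: "(\<Sum>b\<in>UNIV. r b * c t $ b) = 0" for r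
    by (intro holomorphic_fun_eq_0_on_connected[of _ UNIV 0 t]) auto
  have "c t $ a = (\<Sum>b\<in>UNIV. (if b = a then 1 else 0) * c t $ b)" for a
    by (simp add: if_distrib[of "\<lambda>x. x * _"] cong: if_cong)
  then show ?thesis using z by (simp add: vec_eq_iff)
qed

lemma solution_pair_zero: "solution_pair D (\<lambda>t. 0) (\<lambda>t. 0)"
  by (simp add: solution_pair_def)

text \<open>The choice is unique by \<open>solution_pair_unique\<close>, which makes it linear in \<open>a\<close>.\<close>

definition solution_from_origin :: "complex^'n^'n \<Rightarrow> complex^'n \<Rightarrow> complex \<Rightarrow> complex^'n" where
  "solution_from_origin D a = (SOME c. \<exists>c'. solution_pair D c c' \<and> c 0 = 0 \<and> c' 0 = a)"

lemma solution_from_origin: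
  "\<exists>c'. solution_pair D (solution_from_origin D a) c' \<and> solution_from_origin D a 0 = 0 \<and> c' 0 = a"
  unfolding solution_from_origin_def by (rule someI_ex[OF solution_pair_exists])

lemma solution_pair_unique:
  assumes "solution_pair D c c'" "solution_pair D e e'" "c 0 = e 0" "c' 0 = e' 0"
  shows "c = e"
proof
  fix t
  have "(-1) *s e t + c t = 0"
    by (rule solution_pair_eq_0[OF solution_pair_lincomb[OF assms(2,1)]]) (simp_all add: assms vec_eq_iff)
  then show "c t = e t" by (simp add: vec_eq_iff)
qed

lemma solution_from_origin_lincomb:
  "solution_from_origin D (r *s a + b) = (\<lambda>t. r *s solution_from_origin D a t + solution_from_origin D b t)"
proof -
  obtain c' where c: "solution_pair D (solution_from_origin D a) c'" "solution_from_origin D a 0 = 0"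
      "c' 0 = a"
    using solution_from_origin by blast
  obtain e' where e: "solution_pair D (solution_from_origin D b) e'" "solution_from_origin D b 0 = 0"
      "e' 0 = b"
    using solution_from_origin by blast
  obtain h' where h: "solution_pair D (solution_from_origin D (r *s a + b)) h'"
      "solution_from_origin D (r *s a + b) 0 = 0" "h' 0 = r *s a + b"
    using solution_from_origin by blast
  show ?thesis
    by (rule solution_pair_unique[OF h(1) solution_pair_lincomb[OF c(1) e(1)]]) (simp_all add: c e h)
qed

lemma inj_solution_from_origin: "inj (solution_from_origin D)"
proof (rule injI)
  fix a b
  assume eq: "solution_from_origin D a = solution_from_origin D b"
  obtain c' where c: "solution_pair D (solution_from_origin D a) c'" "c' 0 = a"
    using solution_from_origin by blast
  obtain e' where e: "solution_pair D (solution_from_origin D b) e'" "e' 0 = b"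
    using solution_from_origin by blast
  have "c' 0 $ i = e' 0 $ i" for i
    using c(1) e(1) unfolding eq solution_pair_def by (meson DERIV_unique)
  then show "a = b" by (simp add: c(2) e(2) vec_eq_iff)
qed

section \<open>The symmetry condition for a linear system\<close>

lemma partial_t_base:
  assumes "entire f"
  shows "partial_t (\<lambda>t x v. f (t, x)) t x v = dderiv (1, 0) f (t, x)"
  unfolding partial_t_def using DERIV_dderiv[OF assms, of "(0, x)" "(1, 0)" t]
  by (intro DERIV_imp_deriv) simp

lemma scale_axis_1: "s *s axis a 1 = (axis a s :: complex^'n)"
  by (simp add: vec_eq_iff axis_def)

lemma partial_x_base: "partial_x a (\<lambda>t x v. f (t, x)) t x v = dderiv (0, axis a 1) f (t, x)"
  by (simp add: partial_x_def dderiv_def scale_axis_1)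

lemma partial_v_base: "partial_v a (\<lambda>t x v. f (t, x)) t x v = 0"
  by (simp add: partial_v_def)

lemma total_deriv_base:
  assumes "entire f"
  shows "total_deriv w (\<lambda>t x v. f (t, x)) t x v = dderiv (1, v) f (t, x)"
  by (simp add: total_deriv_def partial_t_base[OF assms] partial_x_base[of _ f] partial_v_base[of _ f]
      dderiv_time_space[OF assms, of v] dderiv_space_expansion[OF assms, of v])

lemma prolong1_eq:
  assumes "entire (\<lambda>p. fst (Q p))" and "entire (\<lambda>p. snd (Q p) $ b)"
  shows "prolong1 Q w b t x v = dderiv (1, v) (\<lambda>p. snd (Q p) $ b) (t, x)
           - v $ b * dderiv (1, v) (\<lambda>p. fst (Q p)) (t, x)"
  unfolding prolong1_def field_eta_def field_xi_def
  by (simp add: total_deriv_base[OF assms(1)] total_deriv_base[OF assms(2)])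

lemma DERIV_axis: "((\<lambda>s. (v + axis a s) $ b) has_field_derivative axis b 1 $ a) (at s)"
  by (cases "a = b") (auto simp: axis_def intro!: derivative_eq_intros)

lemma partial_v_prolong1:
  assumes \<xi>: "entire \<xi>" and \<eta>: "entire \<eta>"
  shows "partial_v a (\<lambda>t x v. dderiv (1, v) \<eta> (t, x) - v $ b * dderiv (1, v) \<xi> (t, x)) t x v
     = dderiv (0, axis a 1) \<eta> (t, x) - axis b 1 $ a * dderiv (1, v) \<xi> (t, x)
        - v $ b * dderiv (0, axis a 1) \<xi> (t, x)"
proof -
  have shift: "dderiv (1, v + axis a s) f p = dderiv (1, v) f p + s * dderiv (0, axis a 1) f p"
    if "entire f" for f p s
    using dderiv_add_dir[OF that, of "(1, v)"
        "cscale s (0, axis a 1)"] dderiv_cscale[OF that, of s "(0, axis a 1)"]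
    by (simp add: scale_axis_1)
  have "((\<lambda>s. dderiv (1, v + axis a s) \<eta> (t, x) - (v + axis a s) $ b * dderiv (1, v + axis a s) \<xi> (t, x))
      has_field_derivative dderiv (0, axis a 1) \<eta> (t, x) - axis b 1 $ a * dderiv (1, v) \<xi> (t, x)
        - v $ b * dderiv (0, axis a 1) \<xi> (t, x)) (at 0)"
    unfolding shift[OF \<xi>] shift[OF \<eta>]
    by (rule derivative_eq_intros refl DERIV_axis)+ (simp add: axis_def algebra_simps)
  then show ?thesis unfolding partial_v_def by (rule DERIV_imp_deriv)
qed

text \<open>
  The part of the total derivative in \<open>t\<close> and \<open>x\<close> is the derivative in the direction \<open>(1, v)\<close>; the part
  in \<open>v\<close> is computed by \<open>partial_v_prolong1\<close> and produces the terms with \<open>w\<close>.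
\<close>

lemma prolong2_eq:
  assumes \<xi>: "entire (\<lambda>p. fst (Q p))" and \<eta>: "entire (\<lambda>p. snd (Q p) $ b)"
  shows "prolong2 Q w b t x v =
     dderiv (1, v) (dderiv (1, v) (\<lambda>p. snd (Q p) $ b)) (t, x) + dderiv (0, w) (\<lambda>p. snd (Q p) $ b) (t, x)
     - v $ b * (dderiv (1, v) (dderiv (1, v) (\<lambda>p. fst (Q p))) (t, x)
         + dderiv (0, w) (\<lambda>p. fst (Q p)) (t, x))
     - 2 * w $ b * dderiv (1, v) (\<lambda>p. fst (Q p)) (t, x)"
proof -
  let ?\<xi> = "\<lambda>p. fst (Q p)" and ?\<eta> = "\<lambda>p. snd (Q p) $ b"
  let ?g = "\<lambda>v p. dderiv (1, v) ?\<eta> p - v $ b * dderiv (1, v) ?\<xi> p"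
  have g: "entire (?g v)" and dg: "dderiv u (?g v) p =
      dderiv u (dderiv (1, v) ?\<eta>) p - v $ b * dderiv u (dderiv (1, v) ?\<xi>) p" for u v p
    by (simp_all add: entire_diff entire_cmult entire_dderiv \<xi> \<eta>)
  have p1: "prolong1 Q w b = (\<lambda>t x v. ?g v (t, x))"
    by (intro ext) (simp add: prolong1_eq[OF \<xi> \<eta>])
  have t: "partial_t (prolong1 Q w b) t x v = dderiv (1, 0) (?g v) (t, x)"
    using partial_t_base[OF g[of v]] by (simp add: p1 partial_t_def)
  have x: "partial_x a (prolong1 Q w b) t x v = dderiv (0, axis a 1) (?g v) (t, x)" for a
    using partial_x_base[of a "?g v"] by (simp add: p1 partial_x_def)
  have "(\<Sum>a\<in>UNIV. w $ a * partial_v a (prolong1 Q w b) t x v) =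
     (\<Sum>a\<in>UNIV. w $ a * dderiv (0, axis a 1) ?\<eta> (t, x))
     - (\<Sum>a\<in>UNIV. w $ a * axis b 1 $ a) * dderiv (1, v) ?\<xi> (t, x)
     - v $ b * (\<Sum>a\<in>UNIV. w $ a * dderiv (0, axis a 1) ?\<xi> (t, x))"
    unfolding p1 partial_v_prolong1[OF \<xi> \<eta>]
    by (simp add: sum_subtractf sum.distrib sum_distrib_left sum_distrib_right algebra_simps)
  moreover have "(\<Sum>a\<in>UNIV. w $ a * axis b 1 $ a) = w $ b"
    by (simp add: axis_def if_distrib[of "\<lambda>z. _ * z"] cong: if_cong)
  ultimately have v: "(\<Sum>a\<in>UNIV. w $ a * partial_v a (prolong1 Q w b) t x v) =
      dderiv (0, w) ?\<eta> (t, x) - w $ b * dderiv (1, v) ?\<xi> (t, x) - v $ b * dderiv (0, w) ?\<xi> (t, x)"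
    by (simp only: dderiv_space_expansion[OF \<xi>, of w] dderiv_space_expansion[OF \<eta>, of w])
  have "total_deriv w (prolong1 Q w b) t x v = dderiv (1, v) (?g v) (t, x)
      + (dderiv (0, w) ?\<eta> (t, x) - w $ b * dderiv (1, v) ?\<xi> (t, x) - v $ b * dderiv (0, w) ?\<xi> (t, x))"
    unfolding total_deriv_def v t x
    by (simp only: dderiv_time_space[OF g, of v] dderiv_space_expansion[OF g, of v])
  then show ?thesis
    unfolding prolong2_def field_xi_def by (simp add: total_deriv_base[OF \<xi>] dg algebra_simps)
qed

lemma holomorphic_field_iff:
  "holomorphic_field Q \<longleftrightarrow> entire (\<lambda>p. fst (Q p)) \<and> (\<forall>b. entire (\<lambda>p. snd (Q p) $ b))"
proof
  assume Q: "holomorphic_field Q"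
  define L where "L p = (SOME L. (Q has_derivative L) (at p) \<and> (\<forall>c u. L (cscale c u) = cscale c (L u)))"
      for p
  have "(Q has_derivative L p) (at p) \<and> (\<forall>c u. L p (cscale c u) = cscale c (L p u))" for p
    unfolding L_def by (rule someI_ex[OF Q[unfolded holomorphic_field_def, rule_format]])
  then have L: "\<And>p. (Q has_derivative L p) (at p)" "\<And>p c u. L p (cscale c u) = cscale c (L p u)"
    by blast+
  have "entire (\<lambda>p. fst (Q p))"
    by (rule entireI(1)[of _ "\<lambda>p u. fst (L p u)"]) (rule has_derivative_fst[OF L(1)], simp only: L(2), simp add: cscale_def)
  moreover have "entire (\<lambda>p. snd (Q p) $ b)" for b
    by (rule entireI(1)[of _ "\<lambda>p u. snd (L p u) $ b"])
       (rule has_derivative_vec_nth[OF has_derivative_snd[OF L(1)]], simp only: L(2), simp add: cscale_def)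
  ultimately show "entire (\<lambda>p. fst (Q p)) \<and> (\<forall>b. entire (\<lambda>p. snd (Q p) $ b))" by blast
next
  assume Q: "entire (\<lambda>p. fst (Q p)) \<and> (\<forall>b. entire (\<lambda>p. snd (Q p) $ b))"
  let ?L = "\<lambda>p u. (dderiv u (\<lambda>p. fst (Q p)) p, \<Sum>b\<in>UNIV. axis b (dderiv u (\<lambda>p. snd (Q p) $ b) p))"
  have sum_axis: "(\<Sum>b\<in>UNIV. axis b (y b)) = (\<chi> b. y b)" for y :: "'a \<Rightarrow> complex"
    by (simp add: vec_eq_iff axis_def)
  have bl: "bounded_linear (axis b :: complex \<Rightarrow> complex^'a)" for b
    by (rule linear_conv_bounded_linear[THEN iffD1], rule linearI) (simp_all add: vec_eq_iff axis_def)
  have "((\<lambda>p. (fst (Q p), \<Sum>b\<in>UNIV. axis b (snd (Q p) $ b))) has_derivative ?L p) (at p)" for p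
    by (intro has_derivative_Pair has_derivative_sum bounded_linear.has_derivative[OF bl] entire_has_derivative(1))
       (use Q in auto)
  then have "(Q has_derivative ?L p) (at p)" for p
    by (simp add: sum_axis)
  moreover have "?L p (cscale c u) = cscale c (?L p u)" for p c u
    using Q by (simp add: dderiv_cscale sum_axis vec_eq_iff)
  ultimately show "holomorphic_field Q" unfolding holomorphic_field_def by blast
qed

lemma lie_symmetry_linear_iff:
  fixes D :: "complex^'n^'n"
  shows "lie_symmetry (\<lambda>t x v. D *v x) Q \<longleftrightarrow>
     entire (\<lambda>p. fst (Q p)) \<and> (\<forall>b. entire (\<lambda>p. snd (Q p) $ b)) \<and>
     (\<forall>b t x v. dderiv (1, v) (dderiv (1, v) (\<lambda>p. snd (Q p) $ b)) (t, x)
         + dderiv (0, D *v x) (\<lambda>p. snd (Q p) $ b) (t, x)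
         - v $ b * (dderiv (1, v) (dderiv (1, v) (\<lambda>p. fst (Q p))) (t, x)
             + dderiv (0, D *v x) (\<lambda>p. fst (Q p)) (t, x))
         - 2 * (D *v x) $ b * dderiv (1, v) (\<lambda>p. fst (Q p)) (t, x) = (D *v snd (Q (t, x))) $ b)"
proof -
  let ?F = "\<lambda>b p. (D *v snd p) $ b"
  have pt: "partial_t (\<lambda>t x v. (D *v x) $ b) t x v = 0" for b t x v
    by (simp add: partial_t_def)
  have pv: "partial_v a (\<lambda>t x v. (D *v x) $ b) t x v = 0" for a b t x v
    by (simp add: partial_v_def)
  have px: "partial_x a (\<lambda>t x v. (D *v x) $ b) t x v = dderiv (0, axis a 1) (?F b) (t, x)" for a b t x v
    using partial_x_base[of a "?F b"] by simp
  have "(\<Sum>a\<in>UNIV. field_eta Q t x $ a * partial_x a (\<lambda>t x v. (D *v x) $ b) t x v)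
      = (D *v snd (Q (t, x))) $ b" for b t x v
    unfolding px field_eta_def dderiv_space_expansion[OF entire_matrix_vector(1), symmetric]
    by (simp add: entire_matrix_vector)
  then show ?thesis
    unfolding lie_symmetry_def holomorphic_field_iff
    by (auto simp: pt pv prolong2_eq)
qed

section \<open>The symmetries of a linear system\<close>

text \<open>
  The symmetry condition, with \<open>s v\<close> for \<open>v\<close>, is a cubic polynomial in \<open>s\<close>. Its coefficients of
  degree three and two determine the second derivatives of \<open>\<xi>\<close> and \<open>\<eta>\<close> in the direction \<open>v\<close>, and
  polarization extends this to the mixed derivatives in two directions.
\<close>

lemma lie_symmetry_determining_equations:
  fixes D :: "complex^'n^'n"
  assumes sym: "lie_symmetry (\<lambda>t x v. D *v x) Q"
    and \<xi>_def: "\<xi> = (\<lambda>p. fst (Q p))" and \<eta>_def: "\<And>b. \<eta> b = (\<lambda>p. snd (Q p) $ b)"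
  shows "dderiv (0, v) (dderiv (0, y) \<xi>) p = 0"
    and "dderiv (0, v) (dderiv (0, y) (\<eta> b)) p =
      v $ b * dderiv (1, 0) (dderiv (0, y) \<xi>) p + y $ b * dderiv (1, 0) (dderiv (0, v) \<xi>) p"
    and "2 * dderiv (1, 0) (dderiv (0, v) (\<eta> b)) p
      - v $ b * (dderiv (1, 0) (dderiv (1, 0) \<xi>) p + dderiv (0, D *v snd p) \<xi> p)
      - 2 * (D *v snd p) $ b * dderiv (0, v) \<xi> p = 0"
    and "dderiv (1, 0) (dderiv (1, 0) (\<eta> b)) p + dderiv (0, D *v snd p) (\<eta> b) p
      - 2 * (D *v snd p) $ b * dderiv (1, 0) \<xi> p = (\<Sum>a\<in>UNIV. D $ b $ a * \<eta> a p)"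
proof -
  have e\<xi>: "entire \<xi>" and e\<eta>: "entire (\<eta> b)" for b
    using sym by (simp_all add: lie_symmetry_linear_iff \<xi>_def \<eta>_def)
  have *: "dderiv (1, v) (dderiv (1, v) (\<eta> b)) p + dderiv (0, D *v snd p) (\<eta> b) p
      - v $ b * (dderiv (1, v) (dderiv (1, v) \<xi>) p + dderiv (0, D *v snd p) \<xi> p)
      - 2 * (D *v snd p) $ b * dderiv (1, v) \<xi> p = (D *v snd (Q p)) $ b" for v b p
    using sym unfolding lie_symmetry_linear_iff \<xi>_def \<eta>_def by (cases p) simp
  have dir: "dderiv (1, s *s v) \<xi> p = dderiv (1, 0) \<xi> p + s * dderiv (0, v) \<xi> p" for s v p
    by (simp add: dderiv_time_space[OF e\<xi>, of "s *s v"] dderiv_space_linear[OF e\<xi>])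
  have cubic: "(dderiv (1, 0) (dderiv (1, 0) (\<eta> b)) p + dderiv (0, D *v snd p) (\<eta> b) p
        - 2 * (D *v snd p) $ b * dderiv (1, 0) \<xi> p - (D *v snd (Q p)) $ b)
      + (2 * dderiv (1, 0) (dderiv (0, v) (\<eta> b)) p
          - v $ b * (dderiv (1, 0) (dderiv (1, 0) \<xi>) p + dderiv (0, D *v snd p) \<xi> p)
          - 2 * (D *v snd p) $ b * dderiv (0, v) \<xi> p) * s
      + (dderiv (0, v) (dderiv (0, v) (\<eta> b)) p - 2 * v $ b * dderiv (1, 0) (dderiv (0, v) \<xi>) p) * s^2
      + (- v $ b * dderiv (0, v) (dderiv (0, v) \<xi>) p) * s^3 = 0" for s v b p
    using *[of "s *s v" b p]
    unfolding dderiv_jet_twice[OF e\<xi>] dderiv_jet_twice[OF e\<eta>] dir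
    by (simp add: algebra_simps power2_eq_square power3_eq_cube)
  note coeff = cubic_polynomial_eq_0[OF cubic]
  have polar: "dderiv (0, v + y) (dderiv (0, v + y) f) p = dderiv (0, v) (dderiv (0, v) f) p
     + 2 * dderiv (0, v) (dderiv (0, y) f) p + dderiv (0, y) (dderiv (0, y) f) p" if "entire f"
         for f v y p
    using dderiv_add_dir_twice[OF that, of "(0, v)" "(0, y)" p] by simp
  have \<xi>2: "dderiv (0, v) (dderiv (0, v) \<xi>) p = 0" for v p
  proof (cases "v = 0")
    case True
    then show ?thesis using dderiv_0_dir[OF entire_dderiv[OF e\<xi>]] by (simp add: zero_prod_def)
  next
    case False
    then obtain b where "v $ b \<noteq> 0" by (auto simp: vec_eq_iff)
    then show ?thesis using coeff(4)[of v b p] by simp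
  qed
  show "dderiv (0, v) (dderiv (0, y) \<xi>) p = 0"
    using polar[OF e\<xi>, of v y p] by (simp add: \<xi>2)
  have \<eta>2: "dderiv (0, v) (dderiv (0, v) (\<eta> b)) p = 2 * v $ b * dderiv (1, 0) (dderiv (0, v) \<xi>) p"
      for v b p
    using coeff(3)[of v b p] by simp
  have "dderiv (0, v + y) \<xi> = (\<lambda>p. dderiv (0, v) \<xi> p + dderiv (0, y) \<xi> p)"
    by (rule ext) (rule dderiv_space_linear(1)[OF e\<xi>])
  then have t: "dderiv (1, 0) (dderiv (0, v + y) \<xi>) p
      = dderiv (1, 0) (dderiv (0, v) \<xi>) p + dderiv (1, 0) (dderiv (0, y) \<xi>) p"
    by (simp only: entire_add(2)[OF entire_dderiv[OF e\<xi>] entire_dderiv[OF e\<xi>]])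
  have "2 * dderiv (0, v) (dderiv (0, y) (\<eta> b)) p =
      2 * (v $ b * dderiv (1, 0) (dderiv (0, y) \<xi>) p + y $ b * dderiv (1, 0) (dderiv (0, v) \<xi>) p)"
    using polar[OF e\<eta>, of v y b p] unfolding \<eta>2 t by (simp add: algebra_simps)
  then show "dderiv (0, v) (dderiv (0, y) (\<eta> b)) p =
      v $ b * dderiv (1, 0) (dderiv (0, y) \<xi>) p + y $ b * dderiv (1, 0) (dderiv (0, v) \<xi>) p"
    by (simp only: mult_left_cancel zero_neq_numeral[symmetric] not_False_eq_True)
  show "2 * dderiv (1, 0) (dderiv (0, v) (\<eta> b)) p
      - v $ b * (dderiv (1, 0) (dderiv (1, 0) \<xi>) p + dderiv (0, D *v snd p) \<xi> p)
      - 2 * (D *v snd p) $ b * dderiv (0, v) \<xi> p = 0"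
    by (rule coeff(2))
  show "dderiv (1, 0) (dderiv (1, 0) (\<eta> b)) p + dderiv (0, D *v snd p) (\<eta> b) p
      - 2 * (D *v snd p) $ b * dderiv (1, 0) \<xi> p = (\<Sum>a\<in>UNIV. D $ b $ a * \<eta> a p)"
    using coeff(1)[of b p] by (simp add: matrix_vector_mult_def \<eta>_def)
qed

text \<open>
  The derivative of the coefficient of degree one in a space direction \<open>y\<close> involves \<open>\<eta>\<close> only
  through its second space derivatives, which are known in terms of \<open>\<xi>\<close>. The outcome is the
  relation of \<open>not_scalar_annihilating_covector\<close> for the covector \<open>v \<mapsto> \<xi>\<^sub>v\<close>.
\<close>

lemma lie_symmetry_xi_space_independent:
  fixes D :: "complex^'n^'n"
  assumes sym: "lie_symmetry (\<lambda>t x v. D *v x) Q"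
    and D: "CARD('n) \<ge> 2" "D \<notin> cmat.span {mat 1}"
  shows "dderiv (0, v) (\<lambda>p. fst (Q p)) p = 0"
proof -
  define \<xi> where "\<xi> = (\<lambda>p. fst (Q p))"
  define \<eta> where "\<eta> b = (\<lambda>p. snd (Q p) $ b)" for b
  note det = lie_symmetry_determining_equations[OF sym \<xi>_def \<eta>_def]
  have e\<xi>: "entire \<xi>" and e\<eta>: "entire (\<eta> b)" for b
    using sym by (simp_all add: lie_symmetry_linear_iff \<xi>_def \<eta>_def)
  note e = e\<xi> e\<eta> entire_dderiv
  let ?T = "dderiv (1, 0)" and ?X = "\<lambda>v. dderiv (0, v)"
  have \<xi>2: "?X y (?X v \<xi>) = (\<lambda>p. 0)" for y v
    by (rule ext) (rule det(1))
  have \<eta>2: "?X y (?X v (\<eta> b)) = (\<lambda>p. y $ b * ?T (?X v \<xi>) p + v $ b * ?T (?X y \<xi>) p)" for y v b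
    by (rule ext) (rule det(2))
  have main: "(?T (?T (?X y \<xi>)) p - ?X (D *v y) \<xi> p) *s v + (2 * ?T (?T (?X v \<xi>)) p) *s y
      = (2 * ?X v \<xi> p) *s (D *v y)" for y v p
    unfolding vec_eq_iff
  proof
    fix b
    let ?f1 = "?T (?X v (\<eta> b))" and ?f2 = "?T (?T \<xi>)" and ?f3 = "\<lambda>p. ?X (D *v snd p) \<xi> p"
      and ?f4 = "?X v \<xi>"
    have e3: "entire ?f3" by (rule dderiv_along_linear_vector(1)[OF e\<xi>])
    have e4: "entire (\<lambda>p. (D *v snd p) $ b * ?f4 p)"
        by (rule entire_mult(1)[OF entire_matrix_vector(1) e(3)[OF e\<xi>]])
    have d1: "?X y ?f1 p = v $ b * ?T (?T (?X y \<xi>)) p + y $ b * ?T (?T (?X v \<xi>)) p"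
      unfolding dderiv_commute[OF e(3)[OF e\<eta>], of "(0, y)"] \<eta>2 by (simp add: entire_add entire_cmult e)
    have "?X y (?T \<xi>) = ?T (?X y \<xi>)" by (rule ext) (rule dderiv_commute[OF e\<xi>])
    then have d2: "?X y ?f2 p = ?T (?T (?X y \<xi>)) p"
      by (simp only: dderiv_commute[OF e(3)[OF e\<xi>], of "(0, y)"])
    have d3: "?X y ?f3 p = ?X (D *v y) \<xi> p"
      unfolding dderiv_along_linear_vector(2)[OF e\<xi>] using \<xi>2[of "D *v snd p" y] by simp
    have d4: "?X y (\<lambda>p. (D *v snd p) $ b * ?f4 p) p = (D *v y) $ b * ?X v \<xi> p"
      using \<xi>2[of y v] by (simp add: entire_mult entire_matrix_vector e)
    have "(\<lambda>p. 2 * ?f1 p - v $ b * (?f2 p + ?f3 p) - 2 * ((D *v snd p) $ b * ?f4 p)) = (\<lambda>p. 0)"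
      using det(3)[of v b] by (simp add: fun_eq_iff mult.assoc)
    then have "0 = ?X y (\<lambda>p. 2 * ?f1 p - v $ b * (?f2 p + ?f3 p) - 2 * ((D *v snd p) $ b * ?f4 p)) p"
      by simp
    also have "\<dots> = 2 * ?X y ?f1 p - v $ b * (?X y ?f2 p + ?X y ?f3 p)
       - 2 * ?X y (\<lambda>p. (D *v snd p) $ b * ?f4 p) p"
      by (simp add: entire_diff entire_cmult entire_add e e3 e4 del: snd_conv)
    finally show "((?T (?T (?X y \<xi>)) p - ?X (D *v y) \<xi> p) *s v + (2 * ?T (?T (?X v \<xi>)) p) *s y) $ b
      = ((2 * ?X v \<xi> p) *s (D *v y)) $ b"
      unfolding d1 d2 d3 d4 by (simp add: algebra_simps)
  qed
  show ?thesis
    unfolding \<xi>_def[symmetric]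
    by (rule not_scalar_annihilating_covector[where lam = "\<lambda>v. ?X v \<xi> p", OF D dderiv_space_linear[OF e\<xi>] main])
qed

definition affine_field :: "complex \<Rightarrow> complex \<Rightarrow> complex^'n^'n \<Rightarrow> (complex \<Rightarrow> complex^'n) \<Rightarrow> 'n::finite vector_field" where
  "affine_field \<alpha> \<beta> B c = (\<lambda>p. (\<alpha> + \<beta> * fst p, B *v snd p + c (fst p)))"

lemma affine_field_symmetry:
  fixes D :: "complex^'n^'n"
  assumes B: "B ** D - D ** B = cmat_scale (2 * \<beta>) D" and c: "solution_pair D c c'"
  shows "lie_symmetry (\<lambda>t x v. D *v x) (affine_field \<alpha> \<beta> B c)"
proof -
  let ?Q = "affine_field \<alpha> \<beta> B c"
  have \<xi>: "(\<lambda>p. fst (?Q p)) = (\<lambda>p. \<alpha> + \<beta> * fst p)"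
    and \<eta>: "(\<lambda>p. snd (?Q p) $ b) = (\<lambda>p. (B *v snd p) $ b + c (fst p) $ b)" for b
    by (simp_all add: affine_field_def)
  have c1: "\<And>t. ((\<lambda>s. c s $ b) has_field_derivative c' t $ b) (at t)"
    and c2: "\<And>t. ((\<lambda>s. c' s $ b) has_field_derivative (D *v c t) $ b) (at t)" for b
    using c by (simp_all add: solution_pair_def)
  have e\<xi>: "entire (\<lambda>p. fst (?Q p))" and d\<xi>: "dderiv u (\<lambda>p. fst (?Q p)) = (\<lambda>p. \<beta> * fst u)" for u
    unfolding \<xi> by (simp_all add: fun_eq_iff entire_add entire_cmult)
  have e\<eta>: "entire (\<lambda>p. snd (?Q p) $ b)"
    and d\<eta>: "dderiv u (\<lambda>p. snd (?Q p) $ b) = (\<lambda>p. (B *v snd u) $ b + fst u * c' (fst p) $ b)" for u b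
    unfolding \<eta> by (simp_all add: fun_eq_iff entire_add entire_matrix_vector entire_comp_fst[OF c1])
  have d2: "dderiv u (\<lambda>p. (B *v snd u) $ b + fst u * c' (fst p) $ b) p
      = fst u * ((D *v c (fst p)) $ b * fst u)" for u b p
    by (simp add: entire_add entire_cmult entire_comp_fst[OF c2])
  have "B *v (D *v x) = D *v (B *v x) + (2 * \<beta>) *s (D *v x)" for x
    using B unfolding commutator_vector by (simp add: algebra_simps)
  then have "(B *v (D *v x)) $ b = (D *v (B *v x)) $ b + 2 * \<beta> * (D *v x) $ b" for x b
    by simp
  then show ?thesis
    unfolding lie_symmetry_linear_iff d\<xi> d\<eta> d2
    by (auto simp: e\<xi>[unfolded \<xi>] e\<eta>[unfolded \<eta>] affine_field_def matrix_vector_right_distrib)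
qed

text \<open>
  With \<open>\<xi>\<close> independent of \<open>x\<close>, the remaining equations say that \<open>\<eta>\<close> is affine in \<open>x\<close>, that the
  \<open>x\<close>-derivative of \<open>\<eta>\<close> minus \<open>\<xi>\<^sub>t / 2\<close> times the unit matrix is a constant matrix \<open>H\<close>, and that \<open>\<xi>\<^sub>t\<close> is constant.
\<close>

lemma lie_symmetry_imp_affine:
  fixes D :: "complex^'n^'n"
  assumes sym: "lie_symmetry (\<lambda>t x v. D *v x) Q"
    and D: "CARD('n) \<ge> 2" "D \<notin> cmat.span {mat 1}"
  obtains \<alpha> \<beta> B c c' where "B ** D - D ** B = cmat_scale (2 * \<beta>) D" "solution_pair D c c'"
    "Q = affine_field \<alpha> \<beta> B c"
proof -
  define \<xi> where "\<xi> = (\<lambda>p. fst (Q p))"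
  define \<eta> where "\<eta> b = (\<lambda>p. snd (Q p) $ b)" for b
  note det = lie_symmetry_determining_equations[OF sym \<xi>_def \<eta>_def]
  have e\<xi>: "entire \<xi>" and e\<eta>: "entire (\<eta> b)" for b
    using sym by (simp_all add: lie_symmetry_linear_iff \<xi>_def \<eta>_def)
  note e = e\<xi> e\<eta> entire_dderiv
  let ?T = "dderiv (1, 0)" and ?X = "\<lambda>v. dderiv (0, v)"
  have \<xi>x: "?X v \<xi> = (\<lambda>p. 0)" for v
    unfolding \<xi>_def by (rule ext) (rule lie_symmetry_xi_space_independent[OF sym D])
  have \<xi>tx: "?X v (?T \<xi>) p = 0" for v p
    unfolding dderiv_commute[OF e\<xi>, of "(0, v)"] \<xi>x by simp
  have \<eta>xx: "?X y (?X v (\<eta> b)) p = 0" for y v b p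
    using det(2)[of y v b p] by (simp add: \<xi>x)
  have \<eta>tx: "?T (?X v (\<eta> b)) p = v $ b / 2 * ?T (?T \<xi>) p" for v b p
    using det(3)[of v b p] by (simp add: \<xi>x field_simps)
  \<comment> \<open>The value at the origin of a function that is constant by the next step.\<close>
  define H where "H = (\<chi> b a. ?X (axis a 1) (\<eta> b) 0 - axis a 1 $ b / 2 * ?T \<xi> 0)"
  have \<eta>x_axis: "?X (axis a 1) (\<eta> b) p = axis a 1 $ b / 2 * ?T \<xi> p + H $ b $ a" for a b p
  proof -
    let ?g = "\<lambda>p. ?X (axis a 1) (\<eta> b) p - axis a 1 $ b / 2 * ?T \<xi> p"
    have d: "dderiv u ?g q = dderiv u (?X (axis a 1) (\<eta> b)) q - axis a 1 $ b / 2 * dderiv u (?T \<xi>) q"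
        for u q
      by (simp only: entire_diff(2)[OF e(3)[OF e\<eta>] entire_cmult(1)[OF e(3)[OF e\<xi>]]] entire_cmult(2)[OF e(3)[OF e\<xi>]])
    have "?g p = ?g 0"
    proof (rule entire_constant)
      show "entire ?g" by (rule entire_diff(1)[OF e(3)[OF e\<eta>] entire_cmult(1)[OF e(3)[OF e\<xi>]]])
      show "?X v ?g q = 0" for v q unfolding d \<eta>xx \<xi>tx by simp
      show "?T ?g q = 0" for q unfolding d \<eta>tx by simp
    qed
    then show ?thesis by (simp add: H_def algebra_simps)
  qed
  have \<eta>x: "?X v (\<eta> b) = (\<lambda>p. v $ b / 2 * ?T \<xi> p + (H *v v) $ b)" for v b
  proof
    fix p
    have "?X v (\<eta> b) p = (\<Sum>a\<in>UNIV. v $ a * axis a 1 $ b) / 2 * ?T \<xi> p + (\<Sum>a\<in>UNIV. H $ b $ a * v $ a)"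
      unfolding dderiv_space_expansion[OF e\<eta>, of v] \<eta>x_axis
      by (simp add: sum.distrib sum_divide_distrib sum_distrib_left sum_distrib_right algebra_simps)
    also have "(\<Sum>a\<in>UNIV. v $ a * axis a 1 $ b) = v $ b"
      by (simp add: axis_def if_distrib[of "\<lambda>z. _ * z"] cong: if_cong)
    finally show "?X v (\<eta> b) p = v $ b / 2 * ?T \<xi> p + (H *v v) $ b"
      by (simp add: matrix_vector_mult_def)
  qed
  have scaling: "(?T (?T (?T \<xi>)) p / 2) *s y + (H *v (D *v y) - D *v (H *v y))
      = (2 * ?T \<xi> p) *s (D *v y)" for p y
    unfolding vec_eq_iff
  proof
    fix b
    let ?f2 = "\<lambda>p. ?X (D *v snd p) (\<eta> b) p" and ?f3 = "\<lambda>p. (D *v snd p) $ b * ?T \<xi> p"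
    have e2: "entire ?f2" by (rule dderiv_along_linear_vector(1)[OF e\<eta>])
    have e3: "entire ?f3" by (rule entire_mult(1)[OF entire_matrix_vector(1) e(3)[OF e\<xi>]])
    have t: "?T (?X y (\<eta> b)) = (\<lambda>p. y $ b / 2 * ?T (?T \<xi>) p)"
      by (rule ext) (rule \<eta>tx)
    have "?X y (?T (\<eta> b)) = ?T (?X y (\<eta> b))" by (rule ext) (rule dderiv_commute[OF e\<eta>])
    then have d1: "?X y (?T (?T (\<eta> b))) p = y $ b / 2 * ?T (?T (?T \<xi>)) p"
      by (simp only: dderiv_commute[OF e(3)[OF e\<eta>], of "(0, y)"] t entire_cmult(2)[OF e(3)[OF e(3)[OF e\<xi>]]])
    have d2: "?X y ?f2 p = ?X (D *v y) (\<eta> b) p"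
      unfolding dderiv_along_linear_vector(2)[OF e\<eta>] \<eta>xx by simp
    have d3: "?X y ?f3 p = (D *v y) $ b * ?T \<xi> p"
      by (simp only: entire_mult(2)[OF entire_matrix_vector(1) e(3)[OF e\<xi>]] entire_matrix_vector(2) \<xi>tx
          snd_conv mult_zero_right add_0_left)
    have "(\<lambda>p. ?T (?T (\<eta> b)) p + ?f2 p - 2 * ?f3 p) = (\<lambda>p. \<Sum>a\<in>UNIV. D $ b $ a * \<eta> a p)"
      using det(4)[of b] by (simp add: fun_eq_iff mult.assoc)
    then have "?X y (\<lambda>p. ?T (?T (\<eta> b)) p + ?f2 p - 2 * ?f3 p) p
        = ?X y (\<lambda>p. \<Sum>a\<in>UNIV. D $ b $ a * \<eta> a p) p"
      by simp
    moreover have "?X y (\<lambda>p. ?T (?T (\<eta> b)) p + ?f2 p - 2 * ?f3 p) p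
        = ?X y (?T (?T (\<eta> b))) p + ?X y ?f2 p - 2 * ?X y ?f3 p"
      by (simp only: entire_diff(2)[OF entire_add(1)[OF e(3)[OF e(3)[OF e\<eta>]] e2] entire_cmult(1)[OF e3]]
          entire_add(2)[OF e(3)[OF e(3)[OF e\<eta>]] e2] entire_cmult(2)[OF e3])
    moreover have "?X y (\<lambda>p. \<Sum>a\<in>UNIV. D $ b $ a * \<eta> a p) p = (\<Sum>a\<in>UNIV. D $ b $ a * ?X y (\<eta> a) p)"
      by (simp add: entire_sum(2) entire_cmult e\<eta>)
    moreover have "\<dots> = ?T \<xi> p / 2 * (D *v y) $ b + (D *v (H *v y)) $ b"
      unfolding \<eta>x matrix_vector_mult_def[of D]
      by (simp add: sum.distrib sum_distrib_left algebra_simps)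
    ultimately have "y $ b / 2 * ?T (?T (?T \<xi>)) p + ?X (D *v y) (\<eta> b) p - 2 * ((D *v y) $ b * ?T \<xi> p)
       = ?T \<xi> p / 2 * (D *v y) $ b + (D *v (H *v y)) $ b"
      unfolding d1 d2 d3 by simp
    then show "((?T (?T (?T \<xi>)) p / 2) *s y + (H *v (D *v y) - D *v (H *v y))) $ b = ((2 * ?T \<xi> p) *s (D *v y)) $ b"
      unfolding \<eta>x by (simp add: algebra_simps)
  qed
  define \<beta> where "\<beta> = ?T \<xi> 0"
  have \<xi>t: "?T \<xi> p = \<beta>" for p
  proof -
    \<comment> \<open>The commutator does not depend on the point, so it drops out of the difference of the
      relations at two points.\<close>
    have "((?T (?T (?T \<xi>)) p - ?T (?T (?T \<xi>)) 0) / 2) *s y = (2 * (?T \<xi> p - ?T \<xi> 0)) *s (D *v y)" for y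
      using arg_cong2[OF scaling[of p y] scaling[of 0 y], of minus]
      by (simp add: vec_eq_iff algebra_simps diff_divide_distrib)
    from not_scalar_combination_eq_0[OF D(2) this] show ?thesis by (simp add: \<beta>_def)
  qed
  then have "?T \<xi> = (\<lambda>p. \<beta>)" by (rule ext)
  moreover have "?T (\<lambda>p :: 'n point. \<beta>) = (\<lambda>p. 0)" by (rule ext) simp
  ultimately have \<xi>ttt: "?T (?T (?T \<xi>)) p = 0" for p by simp
  define B where "B = cmat_scale (\<beta> / 2) (mat 1) + H"
  have Bv: "B *v y = (\<beta> / 2) *s y + H *v y" for y
  proof -
    have "cmat_scale (\<beta> / 2) (mat 1) *v y = (\<beta> / 2) *s (mat 1 *v y)"
      by (simp add: cmat_scale_def vec_eq_iff matrix_vector_mult_def sum_distrib_left mult.assoc)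
    then show ?thesis by (simp add: B_def matrix_vector_mult_add_rdistrib)
  qed
  have comm: "B ** D - D ** B = cmat_scale (2 * \<beta>) D"
    using scaling[of 0] unfolding commutator_vector
    by (simp add: \<xi>t \<xi>ttt Bv matrix_vector_right_distrib vector_scalar_commute)
  have \<xi>_const: "\<xi> p - \<beta> * fst p = \<xi> 0 - \<beta> * fst (0 :: 'n point)" for p
    by (rule entire_constant) (simp_all add: entire_diff entire_cmult e \<xi>x \<xi>t)
  have \<xi>_eq: "\<xi> p = \<xi> 0 + \<beta> * fst p" for p
    using \<xi>_const[of p] by (simp add: algebra_simps)
  define c where "c t = snd (Q (t, 0))" for t
  define c' where "c' t = (\<chi> b. ?T (\<eta> b) (t, 0))" for t
  have \<eta>_const: "\<eta> b (t, x) - (B *v snd (t, x)) $ b = \<eta> b (t, 0) - (B *v snd (t, 0 :: complex^'n)) $ b"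
      for b t x
  proof (rule entire_space_constant)
    show "entire (\<lambda>p. \<eta> b p - (B *v snd p) $ b)"
      by (rule entire_diff(1)[OF e\<eta> entire_matrix_vector(1)])
    show "?X v (\<lambda>p. \<eta> b p - (B *v snd p) $ b) p = 0" for v p
      unfolding entire_diff(2)[OF e\<eta> entire_matrix_vector(1)] entire_matrix_vector(2) \<eta>x \<xi>t
      by (simp add: Bv)
  qed
  have \<eta>_eq: "\<eta> b (t, x) = (B *v x) $ b + c t $ b" for b t x
    using \<eta>_const[of b t x] by (simp add: \<eta>_def c_def algebra_simps)
  have "solution_pair D c c'"
    unfolding solution_pair_def
  proof (intro allI conjI)
    fix t b
    show "((\<lambda>s. c s $ b) has_field_derivative c' t $ b) (at t)"
      using DERIV_dderiv[OF e\<eta>, of b "(0, 0)" "(1, 0)" t] by (simp add: c_def c'_def \<eta>_def)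
    have "?T (?T (\<eta> b)) (t, 0) = (D *v c t) $ b"
    proof -
      have "?X (D *v 0) (\<eta> b) (t, 0) = 0" using dderiv_0_dir[OF e\<eta>] by (simp add: zero_prod_def)
      moreover have "(D *v c t) $ b = (\<Sum>a\<in>UNIV. D $ b $ a * \<eta> a (t, 0))"
        by (simp add: matrix_vector_mult_def c_def \<eta>_def)
      ultimately show ?thesis using det(4)[of b "(t, 0)"] by simp
    qed
    then show "((\<lambda>s. c' s $ b) has_field_derivative (D *v c t) $ b) (at t)"
      using DERIV_dderiv[OF e(3)[OF e\<eta>], of "(1, 0)" b "(0, 0)" "(1, 0)" t] by (simp add: c'_def)
  qed
  moreover have "Q = affine_field (\<xi> 0) \<beta> B c"
  proof (rule ext)
    fix p :: "'n point"
    obtain t x where p: "p = (t, x)" by (cases p)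
    show "Q p = affine_field (\<xi> 0) \<beta> B c p"
      using \<xi>_eq[of p] \<eta>_eq[of _ t x]
      by (simp add: p affine_field_def prod_eq_iff vec_eq_iff \<xi>_def \<eta>_def)
  qed
  ultimately show ?thesis using that comm by blast
qed

section \<open>Bases of kernels and images\<close>

text \<open>
  Unlike \<open>dim\<close>, which is \<open>0\<close> for a space of infinite dimension, this includes finiteness, and so it
  can be passed from kernel and image to the whole space.
\<close>

definition has_basis_of_card ::
  "('a::field \<Rightarrow> 'b::ab_group_add \<Rightarrow> 'b) \<Rightarrow> 'b set \<Rightarrow> nat \<Rightarrow> bool" where
  "has_basis_of_card s S n \<longleftrightarrow>
     (\<exists>B. finite B \<and> \<not> module.dependent s B \<and> module.span s B = S \<and> card B = n)"

lemma (in vector_space) dim_of_basis_card: "has_basis_of_card scale S n \<Longrightarrow> dim S = n"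
  by (auto simp: has_basis_of_card_def dim_eq_card_independent)

text \<open>
  Rank and nullity for the restriction of \<open>f\<close> to a subspace \<open>S\<close> of a space that may have infinite
  dimension: a basis of the kernel together with preimages of a basis of the image is a basis of \<open>S\<close>.
\<close>

lemma (in Vector_Spaces.linear) kernel_image_basis_card:
  assumes S: "vs1.subspace S"
    and ker: "has_basis_of_card s1 {x \<in> S. f x = 0} k"
    and im: "has_basis_of_card s2 (f ` S) m"
  shows "has_basis_of_card s1 S (k + m)"
proof -
  obtain A where A: "finite A" "vs1.independent A" "vs1.span A = {x \<in> S. f x = 0}" "card A = k"
    using ker unfolding has_basis_of_card_def by blast
  obtain C where C: "finite C" "vs2.independent C" "vs2.span C = f ` S" "card C = m"
    using im unfolding has_basis_of_card_def by blast
  have "C \<subseteq> f ` S" using vs2.span_superset[of C] by (simp only: C(3))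
  then have "\<forall>c\<in>C. \<exists>x. x \<in> S \<and> f x = c" by blast
  from bchoice[OF this] obtain g
    where g: "\<And>c. c \<in> C \<Longrightarrow> g c \<in> S" "\<And>c. c \<in> C \<Longrightarrow> f (g c) = c" by blast
  have AS: "A \<subseteq> S" and fA: "\<And>a. a \<in> A \<Longrightarrow> f a = 0"
    using vs1.span_superset[of A] unfolding A(3) by auto
  have indep: "vs1.independent (A \<union> g ` C') \<and> card (A \<union> g ` C') = k + card C'" if "C' \<subseteq> C" for C'
    using finite_subset[OF that C(1)] that
  proof (induction C' rule: finite_induct)
    case empty
    then show ?case using A by simp
  next
    case (insert c C')
    have notin: "g c \<notin> vs1.span (A \<union> g ` C')"
    proof
      assume "g c \<in> vs1.span (A \<union> g ` C')"
      then have "f (g c) \<in> vs2.span (f ` (A \<union> g ` C'))" unfolding span_image by blast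
      moreover have "f ` (A \<union> g ` C') \<subseteq> insert 0 (C - {c})"
        using fA g insert.hyps insert.prems by auto
      ultimately have "f (g c) \<in> vs2.span (C - {c})"
        using vs2.span_mono vs2.span_insert_0 by blast
      then show False using C(2) g(2)[of c] insert.prems unfolding vs2.dependent_def by auto
    qed
    have "g c \<notin> A \<union> g ` C'" by (rule contrapos_nn[OF notin]) (rule vs1.span_base)
    with notin show ?case
      using insert A(1) by (simp add: vs1.independent_insertI)
  qed
  have "vs1.span (A \<union> g ` C) = S"
  proof
    show "vs1.span (A \<union> g ` C) \<subseteq> S"
      by (rule vs1.span_minimal[OF _ S]) (use AS g in auto)
    show "S \<subseteq> vs1.span (A \<union> g ` C)"
    proof
      fix x assume x: "x \<in> S"
      have "C = f ` g ` C" using g(2) by force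
      then have "f x \<in> f ` vs1.span (g ` C)"
        using x C(3) span_image[of "g ` C"] by auto
      then obtain y where y: "y \<in> vs1.span (g ` C)" "f x = f y" by blast
      have "y \<in> S" using y(1) vs1.span_minimal[OF _ S, of "g ` C"] g(1) by blast
      then have "x - y \<in> vs1.span A"
        using x y(2) by (simp add: A(3) diff vs1.subspace_diff[OF S])
      then have "(x - y) + y \<in> vs1.span (A \<union> g ` C)"
        using y(1) vs1.span_mono[of A "A \<union> g ` C"] vs1.span_mono[of "g ` C" "A \<union> g ` C"]
        by (intro vs1.span_add) auto
      then show "x \<in> vs1.span (A \<union> g ` C)" by simp
    qed
  qed
  then show ?thesis
    unfolding has_basis_of_card_def
    by (intro exI[of _ "A \<union> g ` C"]) (simp add: indep[OF subset_refl] A(1) C(1,4))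
qed

lemma (in Vector_Spaces.linear) subspace_kernel_within:
  assumes "vs1.subspace S"
  shows "vs1.subspace {x \<in> S. f x = 0}"
  using assms unfolding vs1.subspace_def by (simp add: zero add scale)

lemma (in Vector_Spaces.linear) injective_image_basis_card:
  assumes "inj f" "has_basis_of_card s1 S n"
  shows "has_basis_of_card s2 (f ` S) n"
proof -
  obtain A where A: "finite A" "vs1.independent A" "vs1.span A = S" "card A = n"
    using assms(2) unfolding has_basis_of_card_def by blast
  have "vs2.independent (f ` A)"
    using A(2) by (rule independent_injective_image) (rule inj_on_subset[OF assms(1) subset_UNIV])
  moreover have "card (f ` A) = n" using A(4) inj_on_subset[OF assms(1) subset_UNIV]
      by (metis card_image)
  ultimately show ?thesis
    unfolding has_basis_of_card_def by (intro exI[of _ "f ` A"]) (simp add: A(1,3) span_image)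
qed

lemma has_basis_of_card_field: "has_basis_of_card ((*) :: complex \<Rightarrow> _) UNIV 1"
proof -
  have "x \<in> vector_space_over_itself.span {1}" for x :: complex
    using vector_space_over_itself.span_scale[OF vector_space_over_itself.span_base[of 1 "{1}"], of x] by simp
  then show ?thesis
    unfolding has_basis_of_card_def by (intro exI[of _ "{1}"]) auto
qed

lemma has_basis_of_card_vec: "has_basis_of_card (*s) (UNIV :: (complex^'n) set) CARD('n)"
  unfolding has_basis_of_card_def
  by (intro exI[of _ cart_basis]) (simp add: finite_cart_basis independent_cart_basis card_cart_basis)

lemma has_basis_of_card_cmat:
  assumes "cmat.subspace (S :: (complex^'n^'n) set)"
  shows "has_basis_of_card cmat_scale S (cmat.dim S)"
proof -
  obtain B where B: "B \<subseteq> S" "cmat.independent B" "S \<subseteq> cmat.span B" "card B = cmat.dim S"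
    by (rule cmat.basis_exists)
  define U where "U = (\<lambda>(i, j). axis i (axis j 1) :: complex^'n^'n) ` UNIV"
  have "H \<in> cmat.span U" for H :: "complex^'n^'n"
  proof -
    have entry: "cmat_scale c (axis i (axis j 1)) $ k $ l = (if i = k then if j = l then c else 0 else 0)"
      for c and i j k l :: 'n
      by (simp add: cmat_scale_def axis_def)
    have "(\<Sum>j\<in>UNIV. cmat_scale (H $ i $ j) (axis i (axis j 1)) $ k $ l)
        = (if i = k then H $ i $ l else 0)"
      for i k l :: 'n
      by (cases "i = k") (simp_all add: entry)
    then have "H = (\<Sum>i\<in>UNIV. \<Sum>j\<in>UNIV. cmat_scale (H $ i $ j) (axis i (axis j 1)))"
      by (simp add: vec_eq_iff)
    also have "\<dots> \<in> cmat.span U"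
      by (intro cmat.span_sum cmat.span_scale cmat.span_base) (auto simp: U_def)
    finally show ?thesis .
  qed
  then have "finite B"
    using cmat.independent_span_bound[of U B] B(2) by (auto simp: U_def)
  moreover have "cmat.span B = S"
    using B(1,3) cmat.span_minimal[OF B(1) assms] by blast
  ultimately show ?thesis
    unfolding has_basis_of_card_def by (intro exI[of _ B]) (simp add: B(2,4))
qed

section \<open>The dimension of the symmetry algebra\<close>

lemma affine_field_lincomb:
  "vf_scale r (affine_field \<alpha> \<beta> B c) + affine_field \<alpha>' \<beta>' B' c'
     = affine_field (r * \<alpha> + \<alpha>') (r * \<beta> + \<beta>') (cmat_scale r B + B') (\<lambda>t. r *s c t + c' t)"
proof
  fix p
  have "(cmat_scale r B + B') *v x = r *s (B *v x) + B' *v x" for x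
    by (simp add: cmat_scale_def vec_eq_iff matrix_vector_mult_def sum_distrib_left sum.distrib distrib_right mult.assoc)
  then show "(vf_scale r (affine_field \<alpha> \<beta> B c) + affine_field \<alpha>' \<beta>' B' c') p =
     affine_field (r * \<alpha> + \<alpha>') (r * \<beta> + \<beta>') (cmat_scale r B + B') (\<lambda>t. r *s c t + c' t) p"
    by (simp add: affine_field_def vf_scale_def cscale_def vec_eq_iff algebra_simps)
qed

text \<open>
  The parameters of an affine field are read off from its values at a few points, and not from its
  derivatives, because this defines linear maps on the space of all fields.
\<close>

definition beta_part :: "'n::finite vector_field \<Rightarrow> complex" where
  "beta_part Q = fst (Q (1, 0)) - fst (Q (0, 0))"

definition matrix_part :: "'n::finite vector_field \<Rightarrow> complex^'n^'n" where
  "matrix_part Q = (\<chi> i j. snd (Q (0, axis j 1)) $ i - snd (Q (0, 0)) $ i)"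

definition alpha_part :: "'n::finite vector_field \<Rightarrow> complex" where
  "alpha_part Q = fst (Q (0, 0))"

definition shift_part :: "'n::finite vector_field \<Rightarrow> complex^'n" where
  "shift_part Q = snd (Q (0, 0))"

lemma affine_field_parts [simp]:
  "beta_part (affine_field \<alpha> \<beta> B c) = \<beta>"
  "matrix_part (affine_field \<alpha> \<beta> B c) = B"
  "alpha_part (affine_field \<alpha> \<beta> B c) = \<alpha>"
  "shift_part (affine_field \<alpha> \<beta> B c) = c 0"
  by (simp_all add: beta_part_def matrix_part_def alpha_part_def shift_part_def affine_field_def
      vec_eq_iff matrix_vector_axis_nth)

lemma linear_parts:
  "Vector_Spaces.linear vf_scale (*) beta_part"
  "Vector_Spaces.linear vf_scale cmat_scale matrix_part"
  "Vector_Spaces.linear vf_scale (*) alpha_part"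
  "Vector_Spaces.linear vf_scale (*s) shift_part"
  by (auto simp: Vector_Spaces.linear_iff vf.vector_space_axioms cmat.vector_space_axioms
      vec.vector_space_axioms vector_space_over_itself.vector_space_axioms
      beta_part_def matrix_part_def alpha_part_def shift_part_def
      vf_scale_def cscale_def cmat_scale_def vec_eq_iff algebra_simps)

definition affine_symmetries :: "complex^'n^'n \<Rightarrow> 'n::finite vector_field set" where
  "affine_symmetries D = {affine_field \<alpha> \<beta> B c | \<alpha> \<beta> B c c'.
     B ** D - D ** B = cmat_scale (2 * \<beta>) D \<and> solution_pair D c c'}"

lemma affine_symmetriesI:
  "B ** D - D ** B = cmat_scale (2 * \<beta>) D \<Longrightarrow> solution_pair D c c' \<Longrightarrow>
     affine_field \<alpha> \<beta> B c \<in> affine_symmetries D"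
  unfolding affine_symmetries_def by blast

lemma subspace_affine_symmetries: "vf.subspace (affine_symmetries D)"
proof -
  have lincomb: "vf_scale r Q + Q' \<in> affine_symmetries D"
    if mem: "Q \<in> affine_symmetries D" "Q' \<in> affine_symmetries D" for r Q Q'
  proof -
    obtain \<alpha> \<beta> B c c' where Q: "Q = affine_field \<alpha> \<beta> B c"
        "B ** D - D ** B = cmat_scale (2 * \<beta>) D" "solution_pair D c c'"
      using mem(1) unfolding affine_symmetries_def by blast
    obtain \<alpha>1 \<beta>1 B1 c1 c1' where Q': "Q' = affine_field \<alpha>1 \<beta>1 B1 c1"
        "B1 ** D - D ** B1 = cmat_scale (2 * \<beta>1) D" "solution_pair D c1 c1'"
      using mem(2) unfolding affine_symmetries_def by blast
    have "(cmat_scale r B + B1) ** D - D ** (cmat_scale r B + B1)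
        = (cmat_scale r B ** D - D ** cmat_scale r B) + (B1 ** D - D ** B1)"
      by (simp add: matrix_add_ldistrib matrix_mul_add_rdistrib)
    also have "\<dots> = cmat_scale (2 * (r * \<beta> + \<beta>1)) D"
      unfolding commutator_cmat_scale Q(2) Q'(2)
      by (simp add: cmat_scale_def vec_eq_iff algebra_simps)
    finally show ?thesis
      unfolding affine_symmetries_def Q(1) Q'(1) affine_field_lincomb
      using solution_pair_lincomb[OF Q(3) Q'(3)] by blast
  qed
  have "affine_field 0 0 0 (\<lambda>t. 0) \<in> affine_symmetries D"
    by (rule affine_symmetriesI[OF _ solution_pair_zero]) (simp add: matrix_mul_zero)
  moreover have "affine_field 0 0 0 (\<lambda>t. 0) = (0 :: 'a vector_field)"
    by (simp add: affine_field_def fun_eq_iff zero_prod_def)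
  ultimately have zero: "0 \<in> affine_symmetries D" by simp
  show ?thesis
    unfolding vf.subspace_def using zero lincomb[of _ 0] lincomb[of _ _ 1] by simp
qed

text \<open>
  Rank and nullity for the four parameters in turn: within the symmetries, \<open>S1\<close> is the kernel
  of \<open>\<beta>\<close>, \<open>S2\<close> that of \<open>B\<close> in \<open>S1\<close>, \<open>S3\<close> that of \<open>\<alpha>\<close> in \<open>S2\<close>, and \<open>S4\<close> that of \<open>c 0\<close> in \<open>S3\<close>. The
  last one consists of the solutions starting at the origin, which correspond to their velocities
  at time \<open>0\<close>.
\<close>

lemma affine_symmetries_basis_card:
  fixes D :: "complex^'n^'n"
  shows "has_basis_of_card vf_scale (affine_symmetries D)
           (2 * CARD('n) + commutant_dim D + (if nilpotent_matrix D then 2 else 1))"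
proof -
  note lin = linear_parts
  let ?S0 = "affine_symmetries D"
  define S1 where "S1 = {Q \<in> ?S0. beta_part Q = 0}"
  define S2 where "S2 = {Q \<in> S1. matrix_part Q = 0}"
  define S3 where "S3 = {Q \<in> S2. alpha_part Q = 0}"
  define S4 where "S4 = {Q \<in> S3. shift_part Q = 0}"
  have sub1: "vf.subspace S1"
    unfolding S1_def by (rule linear.subspace_kernel_within[OF lin(1) subspace_affine_symmetries])
  have sub2: "vf.subspace S2"
    unfolding S2_def by (rule linear.subspace_kernel_within[OF lin(2) sub1])
  have sub3: "vf.subspace S3"
    unfolding S3_def by (rule linear.subspace_kernel_within[OF lin(3) sub2])
  have S1: "S1 = {affine_field \<alpha> 0 B c | \<alpha> B c c'. B ** D = D ** B \<and> solution_pair D c c'}"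
  proof (intro equalityI subsetI)
    fix Q assume "Q \<in> S1"
    then show "Q \<in> {affine_field \<alpha> 0 B c | \<alpha> B c c'. B ** D = D ** B \<and> solution_pair D c c'}"
      by (auto simp: S1_def affine_symmetries_def) blast
  next
    fix Q assume "Q \<in> {affine_field \<alpha> 0 B c | \<alpha> B c c'. B ** D = D ** B \<and> solution_pair D c c'}"
    then show "Q \<in> S1" by (auto simp: S1_def intro!: affine_symmetriesI)
  qed
  have S2: "S2 = {affine_field \<alpha> 0 0 c | \<alpha> c c'. solution_pair D c c'}"
  proof (intro equalityI subsetI)
    fix Q assume "Q \<in> S2"
    then show "Q \<in> {affine_field \<alpha> 0 0 c | \<alpha> c c'. solution_pair D c c'}"
      by (auto simp: S2_def S1) blast
  next
    fix Q assume "Q \<in> {affine_field \<alpha> 0 0 c | \<alpha> c c'. solution_pair D c c'}"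
    then show "Q \<in> S2" by (auto simp: S2_def S1_def matrix_mul_zero intro!: affine_symmetriesI)
  qed
  have S3: "S3 = {affine_field 0 0 0 c | c c'. solution_pair D c c'}"
    unfolding S3_def S2 by auto
  have S4: "S4 = range (\<lambda>a. affine_field 0 0 0 (solution_from_origin D a))"
  proof
    show "S4 \<subseteq> range (\<lambda>a. affine_field 0 0 0 (solution_from_origin D a))"
    proof
      fix Q assume "Q \<in> S4"
      then obtain c c' where c: "Q = affine_field 0 0 0 c" "solution_pair D c c'" "c 0 = 0"
        unfolding S4_def S3 by auto
      obtain e' where e: "solution_pair D (solution_from_origin D (c' 0)) e'"
          "solution_from_origin D (c' 0) 0 = 0" "e' 0 = c' 0"
        using solution_from_origin by blast
      have "c = solution_from_origin D (c' 0)"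
        by (rule solution_pair_unique[OF c(2) e(1)]) (simp_all add: c e)
      then show "Q \<in> range (\<lambda>a. affine_field 0 0 0 (solution_from_origin D a))"
        using c(1) by blast
    qed
    show "range (\<lambda>a. affine_field 0 0 0 (solution_from_origin D a)) \<subseteq> S4"
    proof
      fix Q assume "Q \<in> range (\<lambda>a. affine_field 0 0 0 (solution_from_origin D a))"
      then obtain a where Q: "Q = affine_field 0 0 0 (solution_from_origin D a)" by blast
      obtain c' where c: "solution_pair D (solution_from_origin D a) c'"
          "solution_from_origin D a 0 = 0"
        using solution_from_origin by blast
      have "Q \<in> S3" unfolding S3 Q using c(1) by blast
      then show "Q \<in> S4" by (simp add: S4_def Q c(2))
    qed
  qed
  have lin_sol: "Vector_Spaces.linear (*s) vf_scale (\<lambda>a. affine_field 0 0 0 (solution_from_origin D a))"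
  proof -
    have *: "affine_field 0 0 0 (solution_from_origin D (r *s a + b))
       = vf_scale r (affine_field 0 0 0 (solution_from_origin D a))
           + affine_field 0 0 0 (solution_from_origin D b)" for r a b
      by (simp add: affine_field_lincomb solution_from_origin_lincomb)
    have "solution_from_origin D 0 = (\<lambda>t. 0)"
      using solution_from_origin_lincomb[of D "-1" 0 0] by (simp add: fun_eq_iff)
    then have "affine_field 0 0 0 (solution_from_origin D 0) = 0"
      by (simp add: affine_field_def fun_eq_iff zero_prod_def)
    with *[of _ _ 0] *[of 1] show ?thesis
      by (simp add: Vector_Spaces.linear_iff vf.vector_space_axioms vec.vector_space_axioms)
  qed
  have "inj (\<lambda>a. affine_field 0 0 0 (solution_from_origin D a))"
  proof (rule injI)
    fix a b
    assume "affine_field 0 0 0 (solution_from_origin D a)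
        = affine_field 0 0 0 (solution_from_origin D b)"
    then have "solution_from_origin D a t = solution_from_origin D b t" for t
      by (auto simp: affine_field_def dest: fun_cong[of _ _ "(t, 0)"])
    then show "a = b" using injD[OF inj_solution_from_origin] by blast
  qed
  then have b4: "has_basis_of_card vf_scale S4 CARD('n)"
    unfolding S4 by (rule linear.injective_image_basis_card[OF lin_sol _ has_basis_of_card_vec])
  have "shift_part ` S3 = UNIV"
  proof -
    have "a \<in> shift_part ` S3" for a
    proof -
      obtain c c' where "solution_pair D c c'" "c 0 = a" using solution_pair_exists by blast
      then show ?thesis unfolding S3 by (intro image_eqI[of _ _ "affine_field 0 0 0 c"]) auto
    qed
    then show ?thesis by blast
  qed
  then have "has_basis_of_card (*s) (shift_part ` S3) CARD('n)"
    using has_basis_of_card_vec by (simp only:)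
  then have b3: "has_basis_of_card vf_scale S3 (CARD('n) + CARD('n))"
    by (rule linear.kernel_image_basis_card[OF lin(4) sub3 b4[unfolded S4_def]])
  have "alpha_part ` S2 = UNIV"
  proof -
    have "\<alpha> \<in> alpha_part ` S2" for \<alpha>
      unfolding S2 using solution_pair_zero
          by (intro image_eqI[of _ _ "affine_field \<alpha> 0 0 (\<lambda>t. 0)"]) auto
    then show ?thesis by blast
  qed
  then have "has_basis_of_card (*) (alpha_part ` S2) 1"
    using has_basis_of_card_field by (simp only:)
  then have b2: "has_basis_of_card vf_scale S2 (CARD('n) + CARD('n) + 1)"
    by (rule linear.kernel_image_basis_card[OF lin(3) sub2 b3[unfolded S3_def]])
  have "matrix_part ` S1 = {H. H ** D = D ** H}"
  proof -
    have "H \<in> matrix_part ` S1" if "H ** D = D ** H" for H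
    proof (rule image_eqI)
      show "affine_field 0 0 H (\<lambda>t. 0) \<in> S1" unfolding S1 using solution_pair_zero that by blast
    qed simp
    then show ?thesis unfolding S1 by auto
  qed
  moreover have "cmat.subspace {H. H ** D = D ** H}"
    unfolding cmat.subspace_def
  proof (intro conjI allI ballI impI)
    show "cmat_scale r H \<in> {H. H ** D = D ** H}" if "H \<in> {H. H ** D = D ** H}" for r H
      using that commutator_cmat_scale[of r H D] by simp
  qed (simp_all add: matrix_mul_zero matrix_add_ldistrib matrix_mul_add_rdistrib)
  ultimately have "has_basis_of_card cmat_scale (matrix_part ` S1) (commutant_dim D)"
    unfolding commutant_dim_def by (simp only: has_basis_of_card_cmat)
  then have b1: "has_basis_of_card vf_scale S1 (CARD('n) + CARD('n) + 1 + commutant_dim D)"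
    by (rule linear.kernel_image_basis_card[OF lin(2) sub1 b2[unfolded S2_def]])
  show ?thesis
  proof (cases "nilpotent_matrix D")
    case True
    obtain K where K: "K ** D - D ** K = D"
      using nilpotent_imp_commutator_fixpoint[OF True] by blast
    have "\<beta> \<in> beta_part ` ?S0" for \<beta>
    proof -
      have "affine_field 0 \<beta> (cmat_scale (2 * \<beta>) K) (\<lambda>t. 0) \<in> ?S0"
        using solution_pair_zero commutator_cmat_scale[of "2 * \<beta>" K D]
        unfolding affine_symmetries_def K by blast
      then show ?thesis by (intro image_eqI[of _ _ "affine_field 0 \<beta> (cmat_scale (2 * \<beta>) K) (\<lambda>t. 0)"]) auto
    qed
    then have "beta_part ` ?S0 = UNIV" by blast
    then have "has_basis_of_card (*) (beta_part ` ?S0) 1"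
      using has_basis_of_card_field by (simp only:)
    then have "has_basis_of_card vf_scale ?S0 (CARD('n) + CARD('n) + 1 + commutant_dim D + 1)"
      by (rule linear.kernel_image_basis_card[OF lin(1) subspace_affine_symmetries b1[unfolded S1_def]])
    then show ?thesis using True by (simp add: mult_2 add_ac)
  next
    case False
    have "beta_part Q = 0" if mem: "Q \<in> ?S0" for Q
    proof (rule ccontr)
      assume nz: "beta_part Q \<noteq> 0"
      obtain \<alpha> \<beta> B c where Q: "Q = affine_field \<alpha> \<beta> B c" "B ** D - D ** B = cmat_scale (2 * \<beta>) D"
        using mem unfolding affine_symmetries_def by blast
      let ?K = "cmat_scale (1 / (2 * \<beta>)) B"
      have "?K ** D - D ** ?K = D"
        unfolding commutator_cmat_scale Q(2) using nz Q(1) by simp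
      from commutator_fixpoint_imp_nilpotent[OF this] False show False by simp
    qed
    then have "S1 = ?S0" by (auto simp: S1_def)
    then show ?thesis using b1 False by (simp add: mult_2 add_ac)
  qed
qed

theorem corollary1:
  fixes D :: "complex^'n^'n"
  assumes "CARD('n) \<ge> 2"
    and "D \<notin> cmat.span {mat 1}"
  shows "(\<not> nilpotent_matrix D \<longrightarrow>
            vf.dim (max_lie_algebra (\<lambda>t x v. D *v x)) = 2 * CARD('n) + commutant_dim D + 1) \<and>
         (nilpotent_matrix D \<longrightarrow>
            vf.dim (max_lie_algebra (\<lambda>t x v. D *v x)) = 2 * CARD('n) + commutant_dim D + 2)"
proof -
  have "max_lie_algebra (\<lambda>t x v. D *v x) = affine_symmetries D"
  proof
    show "max_lie_algebra (\<lambda>t x v. D *v x) \<subseteq> affine_symmetries D"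
    proof
      fix Q assume "Q \<in> max_lie_algebra (\<lambda>t x v. D *v x)"
      then have "lie_symmetry (\<lambda>t x v. D *v x) Q" by (simp add: max_lie_algebra_def)
      from this assms show "Q \<in> affine_symmetries D"
        by (rule lie_symmetry_imp_affine) (simp add: affine_symmetriesI)
    qed
    show "affine_symmetries D \<subseteq> max_lie_algebra (\<lambda>t x v. D *v x)"
      unfolding affine_symmetries_def max_lie_algebra_def by (auto intro: affine_field_symmetry)
  qed
  then show ?thesis
    using vf.dim_of_basis_card[OF affine_symmetries_basis_card[of D]] by simp
qed

end
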